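(* Let $\mathcal M=\langle\mathcal S,\mathcal A,P,c,\gamma\rangle$ and $\hat{\mathcal M}=\langle\mathcal S,\mathcal A,\hat P,\hat c,\gamma\rangle$ be two MDPs with costs bounded below, let $w:\mathcal S\to[1,\infty)$ and $\kappa>0$ with $\gamma\kappa<1$. Assume that both models are DP-solvable with respect to $w$, that $\mathcal G(V^\star)\cap\Pi_S(\kappa,w)\neq\emptyset$ and that $\hat{\mathcal G}(\hat V^\star)\cap\Pi_S(\kappa,w)\cap\hat\Pi_S(\kappa,w)\neq\emptyset$. Let $\pi^\star\in\mathcal G(V^\star)\cap\Pi_S(\kappa,w)$ and $\hat\pi^\star\in\hat{\mathcal G}(\hat V^\star)\cap\Pi_S(\kappa,w)\cap\hat\Pi_S(\kappa,w)$. Let $\boldsymbol\alpha=(\alpha_1,\alpha_2)\in\mathbb R^2$ with $\alpha_1>0$. Then: 1. $$\|V^{\hat\pi^\star}-V^\star\|_w\le\frac{1}{\alpha_1(1-\gamma\kappa)}\bigl[\mathcal D_{\boldsymbol\alpha}^{\hat\pi^\star}\hat V^\star+\mathcal D_{\boldsymbol\alpha}^{\pi^\star,\hat\pi^\star}\hat V^\star\bigr]$$ and $$\|V^{\hat\pi^\star}-V^\star\|_w\le\frac{1}{\alpha_1(1-\gamma\kappa)}\mathcal D_{\boldsymbol\alpha}^{\hat\pi^\star}(\alpha_1V^\star)+\frac{1+\gamma\kappa}{\alpha_1(1-\gamma\kappa)^2}\mathcal D_{\boldsymbol\alpha}^{\pi^\star,\hat\pi^\star}(\alpha_1V^\star).$$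 2. If in addition $\mathcal G_{\boldsymbol\alpha}(\hat V^\star)\cap\Pi_S(\kappa,w)\neq\emptyset$, then $$\|V^{\hat\pi^\star}-V^\star\|_w\le\frac{1}{\alpha_1(1-\gamma\kappa)}\bigl[\mathcal D_{\boldsymbol\alpha}^{\hat\pi^\star}\hat V^\star+\mathcal D_{\boldsymbol\alpha}^{\star}\hat V^\star\bigr].$$ 3. If (in addition to the hypotheses preceding item 1) $\hat{\mathcal G}(V^\star_{\boldsymbol\alpha})\cap\hat\Pi_S(\kappa,w)\neq\emptyset$, then $$\|V^{\hat\pi^\star}-V^\star\|_w\le\frac{1}{\alpha_1(1-\gamma\kappa)}\mathcal D_{\boldsymbol\alpha}^{\hat\pi^\star}(\alpha_1V^\star)+\frac{1+\gamma\kappa}{\alpha_1(1-\gamma\kappa)^2}\mathcal D_{\boldsymbol\alpha}^{\star}(\alpha_1V^\star).$$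
   Context: MDPs. An MDP $\mathcal M=\langle\mathcal S,\mathcal A,P,c,\gamma\rangle$ consists of Borel spaces $\mathcal S$ (states) and $\mathcal A$ (actions), a stochastic kernel $P(\cdot\mid s,a)$ from $\mathcal S\times\mathcal A$ to $\mathcal S$, a measurable per-step cost $c:\mathcal S\times\mathcal A\to\mathbb R$ bounded from below, and a discount factor $\gamma\in(0,1)$. The second MDP $\hat{\mathcal M}$ has the same $\mathcal S,\mathcal A,\gamma$ but possibly different kernel $\hat P$ and cost $\hat c$; $c_{\min}\in\mathbb R$ is a constant with $c\ge c_{\min}$ and $\hat c\ge c_{\min}$. A policy is a stochastic kernel $\pi:\mathcal S\to\Delta(\mathcal A)$ (time-homogeneous, possibly randomized); $\Pi$ is the set of all policies. Put $c_\pi(s)=\int_{\mathcal A}c(s,a)\pi(da|s)$, $P_\pi(ds'|s)=\int_{\mathcal A}\pi(da|s)P(ds'|s,a)$. The value function of $\pi$ is $V^\pi(s)=\mathbb E^\pi\bigl[\sum_{t\ge1}\gamma^{t-1}c(S_t,A_t)\mid S_1=s\bigr]$. Function space and operators. $\mathcal V$ is the set of measurable functions $\mathcal S\to[\frac{c_{\min}}{1-\gamma},\infty)\cup\{+\infty\}$. For $w:\mathcal S\to[1,\infty)$, $\|v\|_w=\sup_{s}|v(s)|/w(s)$ (also used for differences of functions) and $\mathcal V_w=\{v\in\mathcal V:\|v\|_w<\infty\}$. Bellman operators (given by these formulas for any measurable $v$ bounded below): $[\mathcal B^\pi v](s)=c_\pi(s)+\gamma\int v(s')P_\pi(ds'|s)$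 and $[\mathcal B^\star v](s)=\inf_{a\in\mathcal A}\{c(s,a)+\gamma\int v(s')P(ds'|s,a)\}$. $\mathcal G(v)=\{\pi\in\Pi:\mathcal B^\pi v=\mathcal B^\star v\}$. DP-solvability. $\mathcal M$ is DP-solvable with respect to $w$ if (i) $\mathcal B^\star v\in\mathcal V_w$ for all $v\in\mathcal V_w$; (ii) there is $V^\star\in\mathcal V_w$ with $V^\star(s)\le V^\pi(s)$ for all $s$ and all $\pi\in\Pi$, with equality at all states for at least one $\pi\in\Pi$; (iii) $V^\star=\mathcal B^\star V^\star$. This $V^\star$ is the optimal value function. Stability. For $\kappa>0$ with $\gamma\kappa<1$, a policy $\pi$ is $(\kappa,w)$ stable for $\mathcal M$ if $\|c_\pi\|_w<\infty$ and $\int w(s')P_\pi(ds'|s)\le\kappa w(s)$ for all $s$. $\Pi_S(\kappa,w)$ is the set of $(\kappa,w)$-stable policies for $\mathcal M$. Hats denote the corresponding objects for $\hat{\mathcal M}$: $\hat V^\pi,\hat V^\star,\hat{\mathcal B}^\pi,\hat{\mathcal B}^\star,\hat{\mathcal G}(v),\hat\Pi_S(\kappa,w)$. $V^{\hat\pi^\star}$ is the value function of $\hat\pi^\star$ in $\mathcal M$. Affine transformation. $\mathcal M_{\boldsymbol\alpha}=\langle\mathcal S,\mathcal A,P,\alpha_1c+\alpha_2,\gamma\rangle$; $V^\star_{\boldsymbol\alpha}$ is its optimal value function, $\mathcal B^\pi_{\boldsymbol\alpha},\mathcal B^\star_{\boldsymbol\alpha}$ its Bellman operators (cost $c$ replaced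 by $\alpha_1c+\alpha_2$ in the formulas), and $\mathcal G_{\boldsymbol\alpha}(v)=\{\pi:\mathcal B^\pi_{\boldsymbol\alpha}v=\mathcal B^\star_{\boldsymbol\alpha}v\}$. Mismatch functionals: $\mathcal D^{\pi,\hat\pi}_{\boldsymbol\alpha}v=\|\mathcal B^\pi_{\boldsymbol\alpha}v-\hat{\mathcal B}^{\hat\pi}v\|_w$ for $\pi\in\Pi_S(\kappa,w)$, $\hat\pi\in\hat\Pi_S(\kappa,w)$; $\mathcal D^\pi_{\boldsymbol\alpha}v=\mathcal D^{\pi,\pi}_{\boldsymbol\alpha}v$ for $\pi\in\Pi_S(\kappa,w)\cap\hat\Pi_S(\kappa,w)$; $\mathcal D^\star_{\boldsymbol\alpha}v=\|\mathcal B^\star_{\boldsymbol\alpha}v-\hat{\mathcal B}^\star v\|_w$. *)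

theory Defs
  imports "HOL-Probability.Probability"
begin

definition borel_space :: "'b::polish_space measure \<Rightarrow> bool" where
  "borel_space N \<longleftrightarrow> (\<exists>X \<in> sets borel. sets N = sets (restrict_space borel X))"

(* Integral of an extended-real function as the difference of the integrals of its positive and
   negative parts (e2ennreal maps negative values to 0).  It is only used for measurable functions
   that are bounded below and for probability measures, so that the second term is finite. *)
definition ext_integral :: "'b measure \<Rightarrow> ('b \<Rightarrow> ereal) \<Rightarrow> ereal" where
  "ext_integral N f =
     enn2ereal (\<integral>\<^sup>+ x. e2ennreal (f x) \<partial>N) - enn2ereal (\<integral>\<^sup>+ x. e2ennreal (- f x) \<partial>N)"

(* States and actions are the spaces of the measures "states M" and "actions M"; only the
   underlying measurable spaces of these two measures matter.  Functions and kernels are total in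
   HOL, and every condition below only concerns their values on these spaces. *)
record ('s, 'a) mdp =
  states :: "'s measure"
  actions :: "'a measure"
  trans :: "'s \<times> 'a \<Rightarrow> 's measure"
  cost :: "'s \<times> 'a \<Rightarrow> real"
  discount :: real

definition is_mdp :: "('s::polish_space, 'a::polish_space) mdp \<Rightarrow> bool" where
  "is_mdp M \<longleftrightarrow>
     borel_space (states M) \<and> borel_space (actions M) \<and>
     trans M \<in> states M \<Otimes>\<^sub>M actions M \<rightarrow>\<^sub>M prob_algebra (states M) \<and>
     cost M \<in> borel_measurable (states M \<Otimes>\<^sub>M actions M) \<and>
     (\<exists>b. \<forall>x \<in> space (states M \<Otimes>\<^sub>M actions M). b \<le> cost M x) \<and>
     0 < discount M \<and> discount M < 1"

definition cost_bound :: "('s, 'a) mdp \<Rightarrow> real \<Rightarrow> bool" where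
  "cost_bound M cmin \<longleftrightarrow> (\<forall>x \<in> space (states M \<Otimes>\<^sub>M actions M). cmin \<le> cost M x)"

definition policies :: "('s, 'a) mdp \<Rightarrow> ('s \<Rightarrow> 'a measure) set" where
  "policies M = states M \<rightarrow>\<^sub>M prob_algebra (actions M)"

definition policy_cost :: "('s, 'a) mdp \<Rightarrow> ('s \<Rightarrow> 'a measure) \<Rightarrow> 's \<Rightarrow> ereal" where
  "policy_cost M \<pi> s = ext_integral (\<pi> s) (\<lambda>a. ereal (cost M (s, a)))"

definition policy_trans :: "('s, 'a) mdp \<Rightarrow> ('s \<Rightarrow> 'a measure) \<Rightarrow> 's \<Rightarrow> 's measure" where
  "policy_trans M \<pi> s = \<pi> s \<bind> (\<lambda>a. trans M (s, a))"

(* Conditional law of the state-action pair at time t (counted from 0) given the earlier pairs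
   h 0, ..., h (t - 1), for the process started in state s. *)
definition step_law ::
  "('s, 'a) mdp \<Rightarrow> ('s \<Rightarrow> 'a measure) \<Rightarrow> 's \<Rightarrow> nat \<Rightarrow> (nat \<Rightarrow> 's \<times> 'a) \<Rightarrow> ('s \<times> 'a) measure" where
  "step_law M \<pi> s t h =
     (if t = 0 then return (states M) s else trans M (h (t - 1))) \<bind>
       (\<lambda>s'. \<pi> s' \<bind> (\<lambda>a. return (states M \<Otimes>\<^sub>M actions M) (s', a)))"

(* The Ionescu-Tulcea measure on infinite state-action trajectories. *)
definition trajectory ::
  "('s, 'a) mdp \<Rightarrow> ('s \<Rightarrow> 'a measure) \<Rightarrow> 's \<Rightarrow> (nat \<Rightarrow> 's \<times> 'a) measure" where
  "trajectory M \<pi> s =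
     projective_family.lim UNIV
       (Ionescu_Tulcea.CI (step_law M \<pi> s) (\<lambda>_. states M \<Otimes>\<^sub>M actions M))
       (\<lambda>_. states M \<Otimes>\<^sub>M actions M)"

definition policy_value :: "('s, 'a) mdp \<Rightarrow> ('s \<Rightarrow> 'a measure) \<Rightarrow> 's \<Rightarrow> ereal" where
  "policy_value M \<pi> s =
     ext_integral (trajectory M \<pi> s) (\<lambda>\<omega>. \<Sum>t. ereal (discount M ^ t * cost M (\<omega> t)))"

definition value_functions :: "('s, 'a) mdp \<Rightarrow> real \<Rightarrow> ('s \<Rightarrow> ereal) set" where
  "value_functions M cmin =
     {v \<in> borel_measurable (states M).
        \<forall>s \<in> space (states M). ereal (cmin / (1 - discount M)) \<le> v s}"

definition wnorm :: "'s measure \<Rightarrow> ('s \<Rightarrow> real) \<Rightarrow> ('s \<Rightarrow> ereal) \<Rightarrow> ennreal" where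
  "wnorm N w v = (SUP s \<in> space N. e2ennreal (\<bar>v s\<bar> / ereal (w s)))"

definition weighted_functions ::
  "('s, 'a) mdp \<Rightarrow> real \<Rightarrow> ('s \<Rightarrow> real) \<Rightarrow> ('s \<Rightarrow> ereal) set" where
  "weighted_functions M cmin w = {v \<in> value_functions M cmin. wnorm (states M) w v < \<infinity>}"

definition bellman :: "('s, 'a) mdp \<Rightarrow> ('s \<Rightarrow> 'a measure) \<Rightarrow> ('s \<Rightarrow> ereal) \<Rightarrow> 's \<Rightarrow> ereal" where
  "bellman M \<pi> v s =
     policy_cost M \<pi> s + ereal (discount M) * ext_integral (policy_trans M \<pi> s) v"

definition bellman_opt :: "('s, 'a) mdp \<Rightarrow> ('s \<Rightarrow> ereal) \<Rightarrow> 's \<Rightarrow> ereal" where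
  "bellman_opt M v s =
     (INF a \<in> space (actions M).
        ereal (cost M (s, a)) + ereal (discount M) * ext_integral (trans M (s, a)) v)"

definition greedy :: "('s, 'a) mdp \<Rightarrow> ('s \<Rightarrow> ereal) \<Rightarrow> ('s \<Rightarrow> 'a measure) set" where
  "greedy M v =
     {\<pi> \<in> policies M. \<forall>s \<in> space (states M). bellman M \<pi> v s = bellman_opt M v s}"

definition is_opt_value :: "('s, 'a) mdp \<Rightarrow> ('s \<Rightarrow> ereal) \<Rightarrow> bool" where
  "is_opt_value M V \<longleftrightarrow>
     (\<forall>\<pi> \<in> policies M. \<forall>s \<in> space (states M). V s \<le> policy_value M \<pi> s) \<and>
     (\<exists>\<pi> \<in> policies M. \<forall>s \<in> space (states M). V s = policy_value M \<pi> s)"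

(* On the state space there is at most one function with this property; the choice only fixes
   irrelevant values outside the state space. *)
definition opt_value :: "('s, 'a) mdp \<Rightarrow> 's \<Rightarrow> ereal" where
  "opt_value M = (SOME V. is_opt_value M V)"

definition dp_solvable :: "('s, 'a) mdp \<Rightarrow> real \<Rightarrow> ('s \<Rightarrow> real) \<Rightarrow> bool" where
  "dp_solvable M cmin w \<longleftrightarrow>
     (\<forall>v \<in> weighted_functions M cmin w. bellman_opt M v \<in> weighted_functions M cmin w) \<and>
     (\<exists>V \<in> weighted_functions M cmin w.
        is_opt_value M V \<and> (\<forall>s \<in> space (states M). V s = bellman_opt M V s))"

(* The weight w is not required to be measurable; for non-measurable w the integral is the lower
   integral.  For measurable w it is the usual one. *)
definition stable_policies ::
  "('s, 'a) mdp \<Rightarrow> real \<Rightarrow> ('s \<Rightarrow> real) \<Rightarrow> ('s \<Rightarrow> 'a measure) set" where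
  "stable_policies M \<kappa> w =
     {\<pi> \<in> policies M. wnorm (states M) w (policy_cost M \<pi>) < \<infinity> \<and>
        (\<forall>s \<in> space (states M).
           (\<integral>\<^sup>+ s'. ennreal (w s') \<partial>policy_trans M \<pi> s) \<le> ennreal (\<kappa> * w s))}"

definition affine_mdp :: "real \<Rightarrow> real \<Rightarrow> ('s, 'a) mdp \<Rightarrow> ('s, 'a) mdp" where
  "affine_mdp \<alpha>1 \<alpha>2 M = M\<lparr>cost := \<lambda>x. \<alpha>1 * cost M x + \<alpha>2\<rparr>"

definition mismatch_policy ::
  "('s, 'a) mdp \<Rightarrow> ('s, 'a) mdp \<Rightarrow> ('s \<Rightarrow> real) \<Rightarrow> real \<Rightarrow> real \<Rightarrow>
   ('s \<Rightarrow> 'a measure) \<Rightarrow> ('s \<Rightarrow> 'a measure) \<Rightarrow> ('s \<Rightarrow> ereal) \<Rightarrow> ennreal" where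
  "mismatch_policy M M' w \<alpha>1 \<alpha>2 \<pi> \<pi>' v =
     wnorm (states M) w (\<lambda>s. bellman (affine_mdp \<alpha>1 \<alpha>2 M) \<pi> v s - bellman M' \<pi>' v s)"

definition mismatch_opt ::
  "('s, 'a) mdp \<Rightarrow> ('s, 'a) mdp \<Rightarrow> ('s \<Rightarrow> real) \<Rightarrow> real \<Rightarrow> real \<Rightarrow> ('s \<Rightarrow> ereal) \<Rightarrow> ennreal" where
  "mismatch_opt M M' w \<alpha>1 \<alpha>2 v =
     wnorm (states M) w (\<lambda>s. bellman_opt (affine_mdp \<alpha>1 \<alpha>2 M) v s - bellman_opt M' v s)"

end

theory Submission
  imports Defs
begin

text \<open>
  Each bound is a perturbation argument for contractions. Write \<open>A\<close> for the model with transformed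
  cost \<open>\<alpha>1 c + \<alpha>2\<close> and \<open>B\<close> for the approximating model \<open>M'\<close>. If \<open>\<pi>\<close> is \<open>(\<kappa>, w)\<close>-stable, its Bellman
  operator \<open>T\<close> contracts the weighted norm with factor \<open>q = \<gamma> \<kappa>\<close>: the costs cancel in a difference, and
  integrating \<open>\<bar>u - v\<bar> \<le> C w\<close> against the transition law gives at most \<open>C \<kappa> w\<close>. So if \<open>u\<close> is
  a fixed point of that operator, every \<open>v\<close> satisfies
  \<open>\<parallel>u - v\<parallel> \<le> \<parallel>T v - v\<parallel> / (1 - q)\<close> (\<open>policy_perturbation\<close>). The optimality operator contracts in the
  same way between two functions that both have stable greedy policies, because each greedy policy is an
  admissible competitor at the other function (\<open>bellman_opt_contraction\<close>, \<open>opt_perturbation\<close>).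

  The four estimates come from choosing \<open>v\<close>. Let \<open>V\<close> and \<open>V'\<close> be the optimal values of \<open>A\<close> and \<open>B\<close>, and
  \<open>U\<close> the value in \<open>A\<close> of the policy \<open>\<pi>'\<close> that is greedy in \<open>B\<close>. With \<open>v = V'\<close>, the residual
  \<open>T V' - V'\<close> is a mismatch because \<open>V'\<close> is fixed by the operators of \<open>B\<close>; two such estimates,
  for \<open>U\<close> and for \<open>V\<close>, are joined by the triangle inequality. With \<open>v = V\<close>, only \<open>U\<close> has to be
  compared with \<open>V\<close>, and the residual is split at the function obtained by applying the operator of \<open>\<pi>'\<close> in \<open>B\<close> to
  \<open>V\<close>; the last estimate also needs the distance of \<open>V'\<close> from \<open>V\<close>, which the optimality operator of \<open>B\<close> provides.

  Two facts connect this to the definitions. First, the value of a stable policy, defined by an integral over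
  trajectories, is a fixed point of finite weighted norm: the expectation of a function of the state-action
  pair at time \<open>t\<close> is the \<open>t\<close>-th power of the transition operator applied to the action average of that function
  (\<open>nn_integral_trajectory\<close>), so that the value is a Neumann series (\<open>policy_value_eq_excess\<close>, \<open>policy_value_fixed_point\<close>). Optimal values are fixed
  points by DP-solvability and greediness. Second, values and Bellman operators transform affinely
  with the cost, so the estimate for \<open>A\<close> is \<open>\<alpha>1\<close> times the estimate for \<open>M\<close>, and adding the constant
  \<open>\<alpha>2 / (1 - \<gamma>)\<close> to a function does not change a mismatch.
\<close>

section \<open>Integrals of extended-real functions\<close>

lemma ext_integral_cong:
  "(\<And>x. x \<in> space N \<Longrightarrow> f x = g x) \<Longrightarrow> ext_integral N f = ext_integral N g"
  unfolding ext_integral_def by (simp cong: nn_integral_cong)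

text \<open>
  On a probability space, subtracting a lower bound turns the difference of two integrals into a single
  nonnegative one plus a constant. Hence the monotone convergence and Tonelli theorems for nonnegative
  integrals apply to costs and values that may be infinite above.
\<close>

lemma ext_integral_shift:
  fixes f :: "'b \<Rightarrow> ereal" and b :: real
  assumes "prob_space N" and f[measurable]: "f \<in> borel_measurable N"
    and lb: "\<And>x. x \<in> space N \<Longrightarrow> ereal b \<le> f x"
  shows "ext_integral N f = enn2ereal (\<integral>\<^sup>+ x. e2ennreal (f x - ereal b) \<partial>N) + ereal b"
proof -
  interpret prob_space N by fact
  define P where "P = (\<integral>\<^sup>+ x. e2ennreal (f x) \<partial>N)"
  define Q where "Q = (\<integral>\<^sup>+ x. e2ennreal (- f x) \<partial>N)"
  define R where "R = (\<integral>\<^sup>+ x. e2ennreal (f x - ereal b) \<partial>N)"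
  \<comment> \<open>\<open>(f - b) + f\<^sup>- + b\<^sup>+ = f\<^sup>+ + b\<^sup>-\<close>: every term is nonnegative, so the identity can be integrated\<close>
  have pt: "e2ennreal (f x - ereal b) + e2ennreal (- f x) + ennreal b = e2ennreal (f x) + ennreal (- b)"
    if "x \<in> space N" for x
    using lb[OF that]
    by (cases "f x"; cases "b \<ge> 0"; cases "0 \<le> real_of_ereal (f x)")
       (auto simp: ennreal_neg e2ennreal_neg ennreal_plus[symmetric] simp del: ennreal_plus)
  have "R + Q + ennreal b = P + ennreal (- b)"
  proof -
    have "R + Q + ennreal b = (\<integral>\<^sup>+ x. e2ennreal (f x - ereal b) + e2ennreal (- f x) + ennreal b \<partial>N)"
      unfolding R_def Q_def by (simp add: nn_integral_add emeasure_space_1)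
    also have "\<dots> = (\<integral>\<^sup>+ x. e2ennreal (f x) + ennreal (- b) \<partial>N)"
      by (rule nn_integral_cong) (rule pt)
    also have "\<dots> = P + ennreal (- b)"
      unfolding P_def by (simp add: nn_integral_add emeasure_space_1)
    finally show ?thesis .
  qed
  moreover have "Q \<le> ennreal (- b)"
  proof -
    have "Q \<le> (\<integral>\<^sup>+ x. ennreal (- b) \<partial>N)"
      unfolding Q_def
    proof (rule nn_integral_mono)
      fix x assume "x \<in> space N"
      from lb[OF this] have "- f x \<le> ereal (- b)" by (cases "f x") auto
      from e2ennreal_mono[OF this] show "e2ennreal (- f x) \<le> ennreal (- b)" by simp
    qed
    then show ?thesis by (simp add: emeasure_space_1)
  qed
  ultimately have "enn2ereal P - enn2ereal Q = enn2ereal R + ereal b"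
    by (cases P; cases Q; cases R; cases "b \<ge> 0")
       (auto simp: ennreal_neg ennreal_plus[symmetric] top_unique enn2ereal_ennreal max_absorb2 zero_ennreal.rep_eq
          simp del: ennreal_plus)
  then show ?thesis
    by (simp add: ext_integral_def P_def Q_def R_def)
qed

lemma ext_integral_affine:
  fixes f :: "'b \<Rightarrow> ereal" and a b k :: real
  assumes N: "prob_space N" and f[measurable]: "f \<in> borel_measurable N"
    and lb: "\<And>x. x \<in> space N \<Longrightarrow> ereal b \<le> f x" and a: "0 < a"
  shows "ext_integral N (\<lambda>x. ereal a * f x + ereal k) = ereal a * ext_integral N f + ereal k"
proof -
  have lb': "ereal (a * b + k) \<le> ereal a * f x + ereal k" if "x \<in> space N" for x
    using lb[OF that] a by (cases "f x") auto
  have pt: "e2ennreal (ereal a * f x + ereal k - ereal (a * b + k)) = ennreal a * e2ennreal (f x - ereal b)"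
    if "x \<in> space N" for x
    using lb[OF that] a
    by (cases "f x") (auto simp: ennreal_mult[symmetric] algebra_simps ennreal_mult_top)
  have shift: "ext_integral N f = enn2ereal (\<integral>\<^sup>+ x. e2ennreal (f x - ereal b) \<partial>N) + ereal b"
    using N f lb by (rule ext_integral_shift)
  have "ext_integral N (\<lambda>x. ereal a * f x + ereal k)
      = enn2ereal (ennreal a * (\<integral>\<^sup>+ x. e2ennreal (f x - ereal b) \<partial>N)) + ereal (a * b + k)"
    by (subst ext_integral_shift[OF N _ lb']) (auto simp: pt nn_integral_cmult cong: nn_integral_cong)
  also have "\<dots> = ereal a * ext_integral N f + ereal k"
    unfolding shift
    using a by (cases "\<integral>\<^sup>+ x. e2ennreal (f x - ereal b) \<partial>N")
      (auto simp: enn2ereal_ennreal ennreal_mult[symmetric] algebra_simps ennreal_mult_top max_absorb2)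
  finally show ?thesis .
qed

lemma ext_integral_real:
  fixes f :: "'b \<Rightarrow> real"
  assumes "integrable N f"
  shows "ext_integral N (\<lambda>x. ereal (f x)) = ereal (\<integral>x. f x \<partial>N)"
proof -
  have "(\<integral>\<^sup>+ x. ennreal (f x) \<partial>N) \<noteq> \<infinity>" "(\<integral>\<^sup>+ x. ennreal (- f x) \<partial>N) \<noteq> \<infinity>"
    using assms by (auto simp: real_integrable_def)
  then show ?thesis
    unfolding ext_integral_def real_lebesgue_integral_def[OF assms]
    by (cases "\<integral>\<^sup>+ x. ennreal (f x) \<partial>N"; cases "\<integral>\<^sup>+ x. ennreal (- f x) \<partial>N")
       (auto simp: enn2ereal_ennreal)
qed

lemma ext_integral_diff_le:
  fixes u v :: "'b \<Rightarrow> ereal"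
  assumes u[measurable]: "u \<in> borel_measurable N" and v[measurable]: "v \<in> borel_measurable N"
    and uf: "\<And>x. x \<in> space N \<Longrightarrow> \<bar>u x\<bar> \<noteq> \<infinity>" and vf: "\<And>x. x \<in> space N \<Longrightarrow> \<bar>v x\<bar> \<noteq> \<infinity>"
    and ui: "(\<integral>\<^sup>+ x. e2ennreal \<bar>u x\<bar> \<partial>N) < \<infinity>" and vi: "(\<integral>\<^sup>+ x. e2ennreal \<bar>v x\<bar> \<partial>N) < \<infinity>"
  shows "\<bar>ext_integral N u\<bar> \<noteq> \<infinity>"
    and "e2ennreal \<bar>ext_integral N u - ext_integral N v\<bar> \<le> (\<integral>\<^sup>+ x. e2ennreal \<bar>u x - v x\<bar> \<partial>N)"
proof -
  define f where "f x = real_of_ereal (u x)" for x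
  define g where "g x = real_of_ereal (v x)" for x
  have fu: "u x = ereal (f x)" and gv: "v x = ereal (g x)" if "x \<in> space N" for x
    using uf[OF that] vf[OF that] by (auto simp: f_def g_def ereal_real)
  have [measurable]: "f \<in> borel_measurable N" "g \<in> borel_measurable N"
    unfolding f_def[abs_def] g_def[abs_def] by measurable
  have f: "integrable N f"
    using ui by (auto simp: integrable_iff_bounded fu cong: nn_integral_cong)
  have g: "integrable N g"
    using vi by (auto simp: integrable_iff_bounded gv cong: nn_integral_cong)
  have eu: "ext_integral N u = ereal (\<integral>x. f x \<partial>N)"
    using ext_integral_real[OF f] by (simp add: fu cong: ext_integral_cong)
  have ev: "ext_integral N v = ereal (\<integral>x. g x \<partial>N)"
    using ext_integral_real[OF g] by (simp add: gv cong: ext_integral_cong)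
  show "\<bar>ext_integral N u\<bar> \<noteq> \<infinity>" by (simp add: eu)
  have "e2ennreal \<bar>ext_integral N u - ext_integral N v\<bar> = ennreal \<bar>\<integral>x. f x - g x \<partial>N\<bar>"
    using f g by (simp add: eu ev)
  also have "\<dots> \<le> ennreal (\<integral>x. \<bar>f x - g x\<bar> \<partial>N)"
    using f g by (intro ennreal_leI) (rule integral_abs_bound)
  also have "\<dots> = (\<integral>\<^sup>+ x. ennreal \<bar>f x - g x\<bar> \<partial>N)"
    using f g by (intro nn_integral_eq_integral[symmetric]) auto
  also have "\<dots> = (\<integral>\<^sup>+ x. e2ennreal \<bar>u x - v x\<bar> \<partial>N)"
    by (rule nn_integral_cong) (simp add: fu gv)
  finally show "e2ennreal \<bar>ext_integral N u - ext_integral N v\<bar> \<le> (\<integral>\<^sup>+ x. e2ennreal \<bar>u x - v x\<bar> \<partial>N)" .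
qed

text \<open>
  The function \<open>g\<close> may fail to be measurable, which rules out pulling \<open>K\<close> out of its integral;
  dividing the measurable function \<open>f\<close> by \<open>K\<close> avoids this. It is applied with \<open>g\<close> the weight.
\<close>

lemma nn_integral_le_mult:
  fixes f g :: "'b \<Rightarrow> ennreal"
  assumes f[measurable]: "f \<in> borel_measurable N" and K: "K < \<infinity>"
    and le: "\<And>x. x \<in> space N \<Longrightarrow> f x \<le> K * g x"
  shows "(\<integral>\<^sup>+ x. f x \<partial>N) \<le> K * (\<integral>\<^sup>+ x. g x \<partial>N)"
proof (cases "K = 0")
  case True
  then have "(\<integral>\<^sup>+ x. f x \<partial>N) = (\<integral>\<^sup>+ x. 0 \<partial>N)"
    using le by (intro nn_integral_cong) auto
  then show ?thesis by simp
next
  case False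
  have "(\<integral>\<^sup>+ x. f x \<partial>N) = (\<integral>\<^sup>+ x. K * (f x / K) \<partial>N)"
    using False K by (intro nn_integral_cong) (simp add: ennreal_times_divide, subst mult.commute, simp add: ennreal_mult_divide_eq)
  also have "\<dots> = K * (\<integral>\<^sup>+ x. f x / K \<partial>N)"
    by (intro nn_integral_cmult) measurable
  also have "\<dots> \<le> K * (\<integral>\<^sup>+ x. g x \<partial>N)"
  proof (intro mult_left_mono nn_integral_mono)
    fix x assume "x \<in> space N"
    then show "f x / K \<le> g x"
      using le[of x] False K
      by (metis divide_right_mono_ennreal ennreal_mult_divide_eq infinity_ennreal_def mult.commute less_irrefl)
  qed simp
  finally show ?thesis .
qed

section \<open>The weighted norm\<close>

text \<open>
  The domain on which the Bellman operators are compared. Unlike \<^const>\<open>weighted_functions\<close>, it allows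
  any lower bound, so that for \<open>w \<ge> 1\<close> it is closed under affine transformations with positive slope.
\<close>

definition weighted_bounded :: "'s measure \<Rightarrow> ('s \<Rightarrow> real) \<Rightarrow> ('s \<Rightarrow> ereal) \<Rightarrow> bool" where
  "weighted_bounded N w v \<longleftrightarrow>
     v \<in> borel_measurable N \<and> (\<exists>b. \<forall>s \<in> space N. ereal b \<le> v s) \<and> wnorm N w v < \<infinity>"

lemma wnorm_leI:
  assumes w: "\<And>s. s \<in> space N \<Longrightarrow> 1 \<le> w s"
    and le: "\<And>s. s \<in> space N \<Longrightarrow> e2ennreal \<bar>v s\<bar> \<le> K * ennreal (w s)"
  shows "wnorm N w v \<le> K"
  unfolding wnorm_def
proof (rule SUP_least)
  fix s assume s: "s \<in> space N"
  have w1: "0 < w s" using w[OF s] by simp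
  show "e2ennreal (\<bar>v s\<bar> / ereal (w s)) \<le> K"
  proof (cases "K")
    case (real k)
    then show ?thesis using le[OF s] w1
      by (cases "v s") (auto simp: ennreal_mult[symmetric] ennreal_le_iff field_simps top_unique)
  qed simp
qed

lemma wnorm_bound:
  assumes w: "1 \<le> w s" and s: "s \<in> space N"
  shows "e2ennreal \<bar>v s\<bar> \<le> wnorm N w v * ennreal (w s)"
proof -
  have w1: "0 < w s" using w by simp
  have "e2ennreal \<bar>v s\<bar> = e2ennreal (\<bar>v s\<bar> / ereal (w s)) * ennreal (w s)"
    using w1 by (cases "v s") (auto simp: ennreal_mult[symmetric] ennreal_top_mult)
  also have "\<dots> \<le> wnorm N w v * ennreal (w s)"
    unfolding wnorm_def using s by (intro mult_right_mono SUP_upper) auto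
  finally show ?thesis .
qed

lemma wnorm_finite:
  assumes "1 \<le> w s" "s \<in> space N" "wnorm N w v < \<infinity>"
  shows "\<bar>v s\<bar> \<noteq> \<infinity>"
proof
  assume "\<bar>v s\<bar> = \<infinity>"
  with wnorm_bound[of w s N v] assms show False
    by (auto simp: top_unique ennreal_mult_eq_top_iff)
qed

lemma wnorm_cong:
  "(\<And>s. s \<in> space N \<Longrightarrow> u s = v s) \<Longrightarrow> wnorm N w u = wnorm N w v"
  unfolding wnorm_def by (rule SUP_cong) auto

lemma wnorm_commute: "wnorm N w (\<lambda>s. u s - v s) = wnorm N w (\<lambda>s. v s - u s)"
proof -
  have "\<bar>u s - v s\<bar> = \<bar>v s - u s\<bar>" for s
    by (cases "u s"; cases "v s") auto
  then show ?thesis by (simp add: wnorm_def)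
qed

text \<open>
  Extended-real subtraction never cancels infinities: \<open>\<bar>x - y\<bar> = \<infinity>\<close> as soon as \<open>x\<close> or \<open>y\<close> is infinite, so the
  inequality is trivial at such points.
\<close>

lemma wnorm_triangle:
  assumes w: "\<And>s. s \<in> space N \<Longrightarrow> 1 \<le> w s"
  shows "wnorm N w (\<lambda>s. u s - z s) \<le> wnorm N w (\<lambda>s. u s - v s) + wnorm N w (\<lambda>s. v s - z s)"
proof (rule wnorm_leI[OF w])
  fix s assume s: "s \<in> space N"
  have "e2ennreal \<bar>u s - z s\<bar> \<le> e2ennreal \<bar>u s - v s\<bar> + e2ennreal \<bar>v s - z s\<bar>"
    by (cases "u s"; cases "v s"; cases "z s") (auto simp: ennreal_plus[symmetric] ennreal_leI simp del: ennreal_plus)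
  also have "\<dots> \<le> wnorm N w (\<lambda>s. u s - v s) * ennreal (w s) + wnorm N w (\<lambda>s. v s - z s) * ennreal (w s)"
    using wnorm_bound[where w = w, OF w[OF s] s, of "\<lambda>s. u s - v s"] wnorm_bound[where w = w, OF w[OF s] s, of "\<lambda>s. v s - z s"]
    by (rule add_mono)
  finally show "e2ennreal \<bar>u s - z s\<bar> \<le> (wnorm N w (\<lambda>s. u s - v s) + wnorm N w (\<lambda>s. v s - z s)) * ennreal (w s)"
    by (simp add: distrib_right)
qed

lemma wnorm_scale:
  assumes "0 \<le> a" "\<And>s. s \<in> space N \<Longrightarrow> 1 \<le> w s"
  shows "wnorm N w (\<lambda>s. ereal a * v s) = ennreal a * wnorm N w v"
proof -
  have "e2ennreal (\<bar>ereal a * v s\<bar> / ereal (w s)) = ennreal a * e2ennreal (\<bar>v s\<bar> / ereal (w s))" if "s \<in> space N" for s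
    using assms(1) assms(2)[OF that]
    by (cases "v s") (auto simp: ennreal_mult[symmetric] abs_mult ennreal_mult_top ereal_infty_mult ereal_mult_infty)
  then show ?thesis
    unfolding wnorm_def by (simp add: SUP_mult_left_ennreal)
qed

text \<open>
  The step from a contraction estimate to a bound: \<open>x \<le> d + q x\<close> with \<open>x\<close> finite can be solved
  for \<open>x\<close>. Finiteness of \<open>x\<close> is essential, since \<open>\<infinity>\<close> satisfies the hypothesis for every \<open>d\<close> when \<open>q > 0\<close>.
\<close>

lemma ennreal_absorb:
  fixes x d :: ennreal and q :: real
  assumes "x \<le> d + ennreal q * x" "x < \<infinity>" "0 \<le> q" "q < 1"
  shows "x \<le> ennreal (1 / (1 - q)) * d"
proof (cases d)
  case (real r)
  from assms(2) obtain y where y: "x = ennreal y" "0 \<le> y" by (cases x) auto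
  have "ennreal y \<le> ennreal (r + q * y)"
    using assms(1,3) y real by (simp add: ennreal_mult[symmetric])
  then have "y \<le> r + q * y"
    using assms(3) y real by (simp add: ennreal_plus[symmetric] ennreal_le_iff del: ennreal_plus)
  then have "y \<le> 1 / (1 - q) * r"
    using assms(4) by (simp add: field_simps)
  then show ?thesis
    using assms(4) y real by (simp add: ennreal_mult[symmetric] ennreal_le_iff)
next
  case top
  then show ?thesis using assms(3,4) by (simp add: ennreal_mult_top)
qed
section \<open>Kernels of a Markov decision process\<close>

lemma is_mdpD:
  assumes "is_mdp M"
  shows "trans M \<in> states M \<Otimes>\<^sub>M actions M \<rightarrow>\<^sub>M prob_algebra (states M)"
    and "cost M \<in> borel_measurable (states M \<Otimes>\<^sub>M actions M)"
    and "0 < discount M" and "discount M < 1"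
  using assms by (auto simp: is_mdp_def)

text \<open>
  The law of the pair of a state and the action drawn there, which is the last stage of
  \<^const>\<open>step_law\<close>.
\<close>

definition policy_step :: "('s, 'a) mdp \<Rightarrow> ('s \<Rightarrow> 'a measure) \<Rightarrow> 's \<Rightarrow> ('s \<times> 'a) measure" where
  "policy_step M \<pi> s = \<pi> s \<bind> (\<lambda>a. return (states M \<Otimes>\<^sub>M actions M) (s, a))"

lemma policy_step_measurable:
  assumes "\<pi> \<in> policies M"
  shows "policy_step M \<pi> \<in> states M \<rightarrow>\<^sub>M prob_algebra (states M \<Otimes>\<^sub>M actions M)"
proof -
  have [measurable]: "\<pi> \<in> states M \<rightarrow>\<^sub>M prob_algebra (actions M)"
    using assms by (simp add: policies_def)
  show ?thesis unfolding policy_step_def[abs_def]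
    by measurable
qed

lemma policy_trans_measurable:
  assumes "is_mdp M" "\<pi> \<in> policies M"
  shows "policy_trans M \<pi> \<in> states M \<rightarrow>\<^sub>M prob_algebra (states M)"
proof -
  note [measurable] = is_mdpD(1)[OF assms(1)]
  have [measurable]: "\<pi> \<in> states M \<rightarrow>\<^sub>M prob_algebra (actions M)"
    using assms by (simp add: policies_def)
  show ?thesis unfolding policy_trans_def[abs_def]
    by measurable
qed

lemma nn_integral_policy_step:
  assumes \<pi>: "\<pi> \<in> policies M" and s: "s \<in> space (states M)"
    and f[measurable]: "f \<in> borel_measurable (states M \<Otimes>\<^sub>M actions M)"
  shows "(\<integral>\<^sup>+ x. f x \<partial>policy_step M \<pi> s) = (\<integral>\<^sup>+ a. f (s, a) \<partial>\<pi> s)"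
proof -
  have m: "\<pi> \<in> states M \<rightarrow>\<^sub>M prob_algebra (actions M)"
    using \<pi> by (simp add: policies_def)
  have sets: "sets (\<pi> s) = sets (actions M)"
    using measurable_space[OF m s] by (simp add: space_prob_algebra)
  have sp: "space (\<pi> s) = space (actions M)"
    using sets by (rule sets_eq_imp_space_eq)
  have "(\<lambda>a. return (states M \<Otimes>\<^sub>M actions M) (s, a)) \<in> actions M \<rightarrow>\<^sub>M subprob_algebra (states M \<Otimes>\<^sub>M actions M)"
    using s by measurable
  then have r: "(\<lambda>a. return (states M \<Otimes>\<^sub>M actions M) (s, a)) \<in> \<pi> s \<rightarrow>\<^sub>M subprob_algebra (states M \<Otimes>\<^sub>M actions M)"
    by (simp cong: measurable_cong_sets add: sets)
  show ?thesis
    unfolding policy_step_def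
    by (subst nn_integral_bind[OF f r])
       (intro nn_integral_cong nn_integral_return, auto simp: sp space_pair_measure s)
qed

lemma nn_integral_policy_trans:
  assumes M: "is_mdp M" and \<pi>: "\<pi> \<in> policies M" and s: "s \<in> space (states M)"
    and f[measurable]: "f \<in> borel_measurable (states M)"
  shows "(\<integral>\<^sup>+ x. f x \<partial>policy_trans M \<pi> s) = (\<integral>\<^sup>+ a. \<integral>\<^sup>+ x. f x \<partial>trans M (s, a) \<partial>\<pi> s)"
proof -
  have m: "\<pi> \<in> states M \<rightarrow>\<^sub>M prob_algebra (actions M)"
    using \<pi> by (simp add: policies_def)
  have sets: "sets (\<pi> s) = sets (actions M)"
    using measurable_space[OF m s] by (simp add: space_prob_algebra)
  note [measurable] = is_mdpD(1)[OF M, THEN measurable_prob_algebraD]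
  have "(\<lambda>a. trans M (s, a)) \<in> actions M \<rightarrow>\<^sub>M subprob_algebra (states M)"
    using s by measurable
  then have r: "(\<lambda>a. trans M (s, a)) \<in> \<pi> s \<rightarrow>\<^sub>M subprob_algebra (states M)"
    by (simp cong: measurable_cong_sets add: sets)
  show ?thesis
    unfolding policy_trans_def by (rule nn_integral_bind[OF f r])
qed

lemma space_policy_trans:
  assumes "is_mdp M" "\<pi> \<in> policies M" "s \<in> space (states M)"
  shows "prob_space (policy_trans M \<pi> s)" "sets (policy_trans M \<pi> s) = sets (states M)"
    "space (policy_trans M \<pi> s) = space (states M)"
  using measurable_space[OF policy_trans_measurable[OF assms(1,2)] assms(3)]
  by (auto simp: space_prob_algebra dest: sets_eq_imp_space_eq)

lemma space_policy:
  assumes "\<pi> \<in> policies M" "s \<in> space (states M)"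
  shows "prob_space (\<pi> s)" "sets (\<pi> s) = sets (actions M)" "space (\<pi> s) = space (actions M)"
  using assms measurable_space[of \<pi> "states M" "prob_algebra (actions M)" s]
  by (auto simp: policies_def space_prob_algebra dest: sets_eq_imp_space_eq)

lemma space_trans:
  assumes "is_mdp M" "s \<in> space (states M)" "a \<in> space (actions M)"
  shows "prob_space (trans M (s, a))" "sets (trans M (s, a)) = sets (states M)"
    "space (trans M (s, a)) = space (states M)"
  using measurable_space[OF is_mdpD(1)[OF assms(1)], of "(s, a)"] assms(2,3)
  by (auto simp: space_prob_algebra space_pair_measure dest: sets_eq_imp_space_eq)

definition transition_op ::
  "('s, 'a) mdp \<Rightarrow> ('s \<Rightarrow> 'a measure) \<Rightarrow> ('s \<Rightarrow> ennreal) \<Rightarrow> 's \<Rightarrow> ennreal" where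
  "transition_op M \<pi> f s = (\<integral>\<^sup>+ x. f x \<partial>policy_trans M \<pi> s)"

lemma transition_op_measurable:
  assumes "is_mdp M" "\<pi> \<in> policies M" and f[measurable]: "f \<in> borel_measurable (states M)"
  shows "transition_op M \<pi> f \<in> borel_measurable (states M)"
  unfolding transition_op_def[abs_def]
  using measurable_prob_algebraD[OF policy_trans_measurable[OF assms(1,2)]]
  by (rule measurable_compose) (rule nn_integral_measurable_subprob_algebra[OF f])

lemma transition_op_pow_measurable:
  assumes "is_mdp M" "\<pi> \<in> policies M" and "f \<in> borel_measurable (states M)"
  shows "(transition_op M \<pi> ^^ t) f \<in> borel_measurable (states M)"
  using assms by (induction t) (auto intro: transition_op_measurable)

lemma transition_op_pow_cong:
  assumes "is_mdp M" "\<pi> \<in> policies M" and eq: "\<And>s. s \<in> space (states M) \<Longrightarrow> f s = g s"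
  shows "s \<in> space (states M) \<Longrightarrow> (transition_op M \<pi> ^^ t) f s = (transition_op M \<pi> ^^ t) g s"
proof (induction t arbitrary: s)
  case (Suc t)
  then show ?case
    by (auto simp: transition_op_def space_policy_trans[OF assms(1,2)] intro!: nn_integral_cong)
qed (simp add: eq)

lemma nn_integral_policy_measurable:
  assumes \<pi>: "\<pi> \<in> policies M" and f[measurable]: "f \<in> borel_measurable (states M \<Otimes>\<^sub>M actions M)"
  shows "(\<lambda>s. \<integral>\<^sup>+ a. f (s, a) \<partial>\<pi> s) \<in> borel_measurable (states M)"
proof -
  have "(\<lambda>s. \<integral>\<^sup>+ x. f x \<partial>policy_step M \<pi> s) \<in> borel_measurable (states M)"
    using measurable_prob_algebraD[OF policy_step_measurable[OF \<pi>]]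
    by (rule measurable_compose) (rule nn_integral_measurable_subprob_algebra[OF f])
  then show ?thesis
    by (simp add: nn_integral_policy_step[OF \<pi> _ f] cong: measurable_cong)
qed

section \<open>Marginals of the trajectory measure\<close>

lemma step_law_Suc:
  "step_law M \<pi> s (Suc t) h = trans M (h t) \<bind> policy_step M \<pi>"
  by (simp add: step_law_def policy_step_def[abs_def])

text \<open>
  The Markov property in kernel form, together with \<open>step_law_Suc\<close>: a step depends only on the last pair,
  and the initial step draws an action at \<open>s\<close>.
\<close>

lemma step_law_0:
  assumes "\<pi> \<in> policies M" and s: "s \<in> space (states M)"
  shows "step_law M \<pi> s 0 h = policy_step M \<pi> s"
  using bind_return[OF measurable_prob_algebraD[OF policy_step_measurable[OF assms(1)]] s]
  by (simp add: step_law_def policy_step_def[abs_def])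

lemma Ionescu_Tulcea_step_law:
  assumes M: "is_mdp M" and \<pi>: "\<pi> \<in> policies M" and s: "s \<in> space (states M)"
  shows "Ionescu_Tulcea (step_law M \<pi> s) (\<lambda>_. states M \<Otimes>\<^sub>M actions M)"
proof -
  let ?X = "states M \<Otimes>\<^sub>M actions M"
  note [measurable] = is_mdpD(1)[OF M] policy_step_measurable[OF \<pi>]
  have *: "step_law M \<pi> s t \<in> (\<Pi>\<^sub>M i\<in>{0..<t}. ?X) \<rightarrow>\<^sub>M prob_algebra ?X" for t
  proof (cases t)
    case 0
    have "policy_step M \<pi> s \<in> space (prob_algebra ?X)"
      using measurable_space[OF policy_step_measurable[OF \<pi>] s] .
    then have "(\<lambda>h. policy_step M \<pi> s) \<in> (\<Pi>\<^sub>M i\<in>{0..<t}. ?X) \<rightarrow>\<^sub>M prob_algebra ?X"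
      by (rule measurable_const)
    then show ?thesis
      unfolding 0 by (simp add: step_law_0[OF \<pi> s, abs_def] cong: measurable_cong)
  next
    case (Suc n)
    have [measurable]: "(\<lambda>h. h n) \<in> (\<Pi>\<^sub>M i\<in>{0..<Suc n}. ?X) \<rightarrow>\<^sub>M ?X"
      by (rule measurable_component_singleton) auto
    show ?thesis
      unfolding Suc step_law_Suc by measurable
  qed
  show ?thesis
  proof (rule Ionescu_Tulcea.intro)
    show "step_law M \<pi> s t \<in> (\<Pi>\<^sub>M i\<in>{0..<t}. ?X) \<rightarrow>\<^sub>M subprob_algebra ?X" for t
      using *[of t] by (rule measurable_prob_algebraD)
    show "prob_space (step_law M \<pi> s t h)" if "h \<in> space (\<Pi>\<^sub>M i\<in>{0..<t}. ?X)" for t h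
      using measurable_space[OF *[of t] that] by (simp add: space_prob_algebra)
  qed
qed

text \<open>
  Any finite-dimensional marginal is a probability measure; the empty index set is the simplest one.
\<close>

lemma (in Ionescu_Tulcea) prob_space_lim: "prob_space PF.lim"
proof (rule prob_space_distrD)
  show "(\<lambda>x. restrict x {}) \<in> PF.lim \<rightarrow>\<^sub>M PiM {} M"
    by (simp add: measurable_cong_sets[OF PF.sets_lim refl])
  show "prob_space (distr PF.lim (PiM {} M) (\<lambda>x. restrict x {}))"
    by (simp add: distr_lim PF.prob_space_P)
qed

lemma (in Ionescu_Tulcea) nn_integral_C_last:
  assumes f[measurable]: "f \<in> borel_measurable (M n)"
  shows "(\<integral>\<^sup>+ h. f (h n) \<partial>C 0 (Suc n) (\<lambda>_. undefined)) = (\<integral>\<^sup>+ h. (\<integral>\<^sup>+ x. f x \<partial>P n h) \<partial>C 0 n (\<lambda>_. undefined))"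
proof -
  have u: "(\<lambda>_. undefined) \<in> space (PiM {0..<0} M)" by simp
  have c: "(\<lambda>h. f (h n)) \<in> borel_measurable (PiM {0..<Suc n} M)"
    by measurable
  have "(\<integral>\<^sup>+ h. f (h n) \<partial>C 0 (Suc n) (\<lambda>_. undefined)) = (\<integral>\<^sup>+ h. (\<integral>\<^sup>+ g. f (g n) \<partial>eP n h) \<partial>C 0 n (\<lambda>_. undefined))"
    using c sets_C[OF u, of n] measurable_eP[of n]
    by (simp, subst nn_integral_bind[where B = "PiM {0..<Suc n} M"]) (auto cong: measurable_cong_sets)
  also have "\<dots> = (\<integral>\<^sup>+ h. (\<integral>\<^sup>+ x. f x \<partial>P n h) \<partial>C 0 n (\<lambda>_. undefined))"
    using c space_C[OF u, of n]
    by (intro nn_integral_cong, subst nn_integral_eP) auto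
  finally show ?thesis .
qed

lemma (in Ionescu_Tulcea) nn_integral_lim_component:
  assumes f[measurable]: "f \<in> borel_measurable (M n)"
  shows "(\<integral>\<^sup>+ \<omega>. f (\<omega> n) \<partial>PF.lim) = (\<integral>\<^sup>+ h. f (h n) \<partial>C 0 (Suc n) (\<lambda>_. undefined))"
proof -
  have r: "(\<lambda>\<omega>. restrict \<omega> {0..<Suc n}) \<in> PF.lim \<rightarrow>\<^sub>M PiM {0..<Suc n} M"
    by (auto simp: measurable_cong_sets[OF PF.sets_lim refl] intro!: measurable_restrict_subset)
  have c: "(\<lambda>h. f (h n)) \<in> borel_measurable (PiM {0..<Suc n} M)"
    by measurable
  have up: "up_to {0..<Suc n} = Suc n"
    by (rule antisym[OF _ Suc_leI[OF up_to_less]]) (auto simp: up_to_iff)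
  have u: "(\<lambda>_. undefined) \<in> space (PiM {0..<0} M)" by simp
  have "(\<integral>\<^sup>+ \<omega>. f (\<omega> n) \<partial>PF.lim) = (\<integral>\<^sup>+ h. f (h n) \<partial>distr PF.lim (PiM {0..<Suc n} M) (\<lambda>\<omega>. restrict \<omega> {0..<Suc n}))"
    by (subst nn_integral_distr[OF r]) (use c in auto)
  also have "\<dots> = (\<integral>\<^sup>+ h. f (h n) \<partial>CI {0..<Suc n})"
    by (simp add: distr_lim)
  also have "\<dots> = (\<integral>\<^sup>+ h. f (h n) \<partial>C 0 (Suc n) (\<lambda>_. undefined))"
    unfolding CI_def up using sets_C[OF u, of "Suc n"]
    by (subst nn_integral_distr)
       (use c in \<open>auto intro!: nn_integral_cong measurable_restrict_subset simp del: C.simps cong: measurable_cong_sets\<close>)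
  finally show ?thesis .
qed

text \<open>
  If the conditional expectation of \<open>f\<close> at time \<open>n + 1\<close> depends on the history only through its
  last entry, then an integral at time \<open>n + 1\<close> reduces to one at time \<open>n\<close>. This is the step of the induction that
  identifies the marginals.
\<close>

lemma (in Ionescu_Tulcea) nn_integral_lim_Markov:
  assumes f[measurable]: "f \<in> borel_measurable (M (Suc n))"
    and g[measurable]: "g \<in> borel_measurable (M n)"
    and step: "\<And>h. h \<in> space (PiM {0..<Suc n} M) \<Longrightarrow> (\<integral>\<^sup>+ x. f x \<partial>P (Suc n) h) = g (h n)"
  shows "(\<integral>\<^sup>+ \<omega>. f (\<omega> (Suc n)) \<partial>PF.lim) = (\<integral>\<^sup>+ \<omega>. g (\<omega> n) \<partial>PF.lim)"
proof -
  have u: "(\<lambda>_. undefined) \<in> space (PiM {0..<0} M)" by simp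
  have "(\<integral>\<^sup>+ \<omega>. f (\<omega> (Suc n)) \<partial>PF.lim) = (\<integral>\<^sup>+ h. g (h n) \<partial>C 0 (Suc n) (\<lambda>_. undefined))"
    unfolding nn_integral_lim_component[OF f] nn_integral_C_last[OF f]
    using space_C[OF u, of "Suc n"] by (intro nn_integral_cong step) (auto simp del: C.simps)
  then show ?thesis by (simp only: nn_integral_lim_component[OF g])
qed

text \<open>
  Induction on \<open>t\<close> for all \<open>f\<close> at once: conditioning on the pair at time \<open>t\<close> replaces \<open>f\<close> by a function
  \<open>g\<close> of that pair, and averaging \<open>g\<close> over the action gives the transition operator applied to the action
  average of \<open>f\<close>.
\<close>

lemma nn_integral_trajectory:
  assumes M: "is_mdp M" and \<pi>: "\<pi> \<in> policies M" and s: "s \<in> space (states M)"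
    and f: "f \<in> borel_measurable (states M \<Otimes>\<^sub>M actions M)"
  shows "(\<integral>\<^sup>+ \<omega>. f (\<omega> t) \<partial>trajectory M \<pi> s) = (transition_op M \<pi> ^^ t) (\<lambda>s. \<integral>\<^sup>+ a. f (s, a) \<partial>\<pi> s) s"
proof -
  interpret IT: Ionescu_Tulcea "step_law M \<pi> s" "\<lambda>_. states M \<Otimes>\<^sub>M actions M"
    by (rule Ionescu_Tulcea_step_law[OF M \<pi> s])
  show ?thesis
    using f
  proof (induction t arbitrary: f)
    case (0 f)
    have u: "(\<lambda>_. undefined) \<in> space (PiM {0..<0::nat} (\<lambda>_. states M \<Otimes>\<^sub>M actions M))"
      by simp
    interpret C: prob_space "IT.C 0 0 (\<lambda>_. undefined)"
      by (rule IT.prob_space_C[OF u])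
    show ?case
      unfolding trajectory_def IT.nn_integral_lim_component[OF 0] IT.nn_integral_C_last[OF 0]
        step_law_0[OF \<pi> s] nn_integral_policy_step[OF \<pi> s 0]
      by (simp add: C.emeasure_space_1 del: IT.C.simps)
  next
    case (Suc t f)
    note f[measurable] = Suc.prems
    note [measurable] = measurable_prob_algebraD[OF is_mdpD(1)[OF M]]
    define f\<pi> where "f\<pi> s' = (\<integral>\<^sup>+ a. f (s', a) \<partial>\<pi> s')" for s'
    have [measurable]: "f\<pi> \<in> borel_measurable (states M)"
      unfolding f\<pi>_def[abs_def] by (rule nn_integral_policy_measurable[OF \<pi> f])
    define g where "g x = (\<integral>\<^sup>+ s'. f\<pi> s' \<partial>trans M x)" for x
    have g[measurable]: "g \<in> borel_measurable (states M \<Otimes>\<^sub>M actions M)"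
      unfolding g_def[abs_def] by measurable
    have "(\<integral>\<^sup>+ \<omega>. f (\<omega> (Suc t)) \<partial>trajectory M \<pi> s) = (\<integral>\<^sup>+ \<omega>. g (\<omega> t) \<partial>trajectory M \<pi> s)"
      unfolding trajectory_def
    proof (rule IT.nn_integral_lim_Markov[OF f g])
      fix h :: "nat \<Rightarrow> 'a \<times> 'b"
      assume "h \<in> space (PiM {0..<Suc t} (\<lambda>_. states M \<Otimes>\<^sub>M actions M))"
      then have h: "h t \<in> space (states M \<Otimes>\<^sub>M actions M)"
        by (auto simp: space_PiM PiE_iff)
      have st: "sets (trans M (h t)) = sets (states M)"
        using measurable_space[OF is_mdpD(1)[OF M] h] by (simp add: space_prob_algebra)
      have "policy_step M \<pi> \<in> trans M (h t) \<rightarrow>\<^sub>M subprob_algebra (states M \<Otimes>\<^sub>M actions M)"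
        using measurable_prob_algebraD[OF policy_step_measurable[OF \<pi>]] st
        by (simp cong: measurable_cong_sets)
      then show "(\<integral>\<^sup>+ x. f x \<partial>step_law M \<pi> s (Suc t) h) = g (h t)"
        unfolding step_law_Suc g_def f\<pi>_def
        by (subst nn_integral_bind[OF f])
           (auto intro!: nn_integral_cong nn_integral_policy_step[OF \<pi> _ f] simp: sets_eq_imp_space_eq[OF st])
    qed
    also have "\<dots> = (transition_op M \<pi> ^^ t) (\<lambda>s. \<integral>\<^sup>+ a. g (s, a) \<partial>\<pi> s) s"
      by (rule Suc.IH[OF g])
    also have "\<dots> = (transition_op M \<pi> ^^ t) (transition_op M \<pi> f\<pi>) s"
      by (rule transition_op_pow_cong[OF M \<pi> _ s])
         (simp add: transition_op_def g_def nn_integral_policy_trans[OF M \<pi>])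
    finally show ?case
      by (simp add: funpow_Suc_right f\<pi>_def[abs_def] del: funpow.simps)
  qed
qed

section \<open>The value of a policy as a discounted series\<close>

text \<open>
  With \<open>b\<close> a lower bound of the cost, the excess over \<open>b\<close> is nonnegative, so its discounted expected sum
  is an unconditional series in \<open>[0, \<infinity>]\<close>.
\<close>

definition excess_cost :: "('s, 'a) mdp \<Rightarrow> real \<Rightarrow> ('s \<Rightarrow> 'a measure) \<Rightarrow> 's \<Rightarrow> ennreal" where
  "excess_cost M b \<pi> s = (\<integral>\<^sup>+ a. ennreal (cost M (s, a) - b) \<partial>\<pi> s)"

definition excess_value :: "('s, 'a) mdp \<Rightarrow> real \<Rightarrow> ('s \<Rightarrow> 'a measure) \<Rightarrow> 's \<Rightarrow> ennreal" where
  "excess_value M b \<pi> s =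
     (\<Sum>t. ennreal (discount M ^ t) * (transition_op M \<pi> ^^ t) (excess_cost M b \<pi>) s)"

lemma excess_cost_measurable:
  assumes "is_mdp M" "\<pi> \<in> policies M"
  shows "excess_cost M b \<pi> \<in> borel_measurable (states M)"
proof -
  note [measurable] = is_mdpD(2)[OF assms(1)]
  show ?thesis unfolding excess_cost_def[abs_def]
    by (rule nn_integral_policy_measurable[OF assms(2)]) measurable
qed

lemma excess_value_measurable:
  assumes "is_mdp M" "\<pi> \<in> policies M"
  shows "excess_value M b \<pi> \<in> borel_measurable (states M)"
  unfolding excess_value_def[abs_def]
  using transition_op_pow_measurable[OF assms excess_cost_measurable[OF assms]]
  by measurable

lemma policy_cost_eq_excess:
  assumes M: "is_mdp M" and \<pi>: "\<pi> \<in> policies M" and b: "cost_bound M b" and s: "s \<in> space (states M)"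
  shows "policy_cost M \<pi> s = enn2ereal (excess_cost M b \<pi> s) + ereal b"
proof -
  note [measurable] = is_mdpD(2)[OF M]
  have "(\<lambda>a. ereal (cost M (s, a))) \<in> borel_measurable (actions M)"
    using s by measurable
  then have "(\<lambda>a. ereal (cost M (s, a))) \<in> borel_measurable (\<pi> s)"
    by (simp cong: measurable_cong_sets add: space_policy[OF \<pi> s])
  then show ?thesis
    unfolding policy_cost_def excess_cost_def
    using b s by (subst ext_integral_shift[OF space_policy(1)[OF \<pi> s], where b = b])
      (auto simp: cost_bound_def space_policy[OF \<pi> s] space_pair_measure)
qed

text \<open>
  The sum of a bounded-below extended-real series splits into a nonnegative part and the geometric series of
  the bound. In particular the series converges, so that its sum is not a default value.
\<close>

lemma discounted_suminf_shift:
  fixes x :: "nat \<Rightarrow> real"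
  assumes g: "0 < g" "g < 1" and b: "\<And>t. b \<le> x t"
  shows "(\<Sum>t. ereal (g ^ t * x t)) = enn2ereal (\<Sum>t. ennreal (g ^ t) * ennreal (x t - b)) + ereal (b / (1 - g))"
proof -
  have "(\<lambda>t. ennreal (g ^ t) * ennreal (x t - b)) sums (\<Sum>t. ennreal (g ^ t) * ennreal (x t - b))"
    by (intro summable_sums summableI)
  then have "(\<lambda>t. enn2ereal (ennreal (g ^ t) * ennreal (x t - b))) sums
      enn2ereal (\<Sum>t. ennreal (g ^ t) * ennreal (x t - b))"
    by (simp only: sums_enn2ereal)
  moreover have "enn2ereal (ennreal (g ^ t) * ennreal (x t - b)) = ereal (g ^ t * (x t - b))" for t
    using g b[of t] by (simp add: ennreal_mult[symmetric] enn2ereal_ennreal)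
  ultimately have 1: "(\<lambda>t. ereal (g ^ t * (x t - b))) sums
      enn2ereal (\<Sum>t. ennreal (g ^ t) * ennreal (x t - b))"
    by simp
  have "(\<lambda>t. g ^ t * b) sums (1 / (1 - g) * b)"
    using g by (intro sums_mult2 geometric_sums) auto
  then have 2: "(\<lambda>t. ereal (g ^ t * b)) sums ereal (b / (1 - g))"
    by (simp add: sums_ereal)
  have "(\<lambda>t. ereal (g ^ t * (x t - b)) + ereal (g ^ t * b)) sums
      (enn2ereal (\<Sum>t. ennreal (g ^ t) * ennreal (x t - b)) + ereal (b / (1 - g)))"
    using tendsto_add_ereal_general[OF _ 1[unfolded sums_def] 2[unfolded sums_def]]
    by (simp add: sums_def sum.distrib)
  then show ?thesis
    by (simp add: algebra_simps sums_iff)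
qed

text \<open>
  Tonelli: the expected sum is the sum of the expectations, each of which is known from the marginals.
\<close>

lemma policy_value_eq_excess:
  assumes M: "is_mdp M" and \<pi>: "\<pi> \<in> policies M" and b: "cost_bound M b" and s: "s \<in> space (states M)"
  shows "policy_value M \<pi> s = enn2ereal (excess_value M b \<pi> s) + ereal (b / (1 - discount M))"
proof -
  interpret IT: Ionescu_Tulcea "step_law M \<pi> s" "\<lambda>_. states M \<Otimes>\<^sub>M actions M"
    by (rule Ionescu_Tulcea_step_law[OF M \<pi> s])
  let ?T = "trajectory M \<pi> s" and ?X = "states M \<Otimes>\<^sub>M actions M"
  have prob: "prob_space ?T"
    unfolding trajectory_def by (rule IT.prob_space_lim)
  have sets: "sets ?T = sets (\<Pi>\<^sub>M t\<in>UNIV. ?X)"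
    unfolding trajectory_def by (rule IT.PF.sets_lim)
  note g = is_mdpD(3,4)[OF M]
  note [measurable] = is_mdpD(2)[OF M]
  have [measurable]: "(\<lambda>\<omega>. \<omega> t) \<in> ?T \<rightarrow>\<^sub>M ?X" for t
    using measurable_component_singleton[of t UNIV "\<lambda>_. ?X"] sets by (simp cong: measurable_cong_sets)
  have lb: "b \<le> cost M (\<omega> t)" if "\<omega> \<in> space ?T" for \<omega> t
    using that b sets_eq_imp_space_eq[OF sets] by (auto simp: cost_bound_def space_PiM PiE_iff)
  let ?S = "\<lambda>\<omega>. \<Sum>t. ennreal (discount M ^ t) * ennreal (cost M (\<omega> t) - b)"
  have "policy_value M \<pi> s = ext_integral ?T (\<lambda>\<omega>. enn2ereal (?S \<omega>) + ereal (b / (1 - discount M)))"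
    unfolding policy_value_def by (intro ext_integral_cong discounted_suminf_shift g lb)
  also have "\<dots> = enn2ereal (\<integral>\<^sup>+ \<omega>. ?S \<omega> \<partial>?T) + ereal (b / (1 - discount M))"
  proof (subst ext_integral_shift[OF prob, where b = "b / (1 - discount M)"])
    show "ereal (b / (1 - discount M)) \<le> enn2ereal (?S \<omega>) + ereal (b / (1 - discount M))" for \<omega>
      by (cases "?S \<omega>") (auto simp: enn2ereal_ennreal)
    have "e2ennreal (enn2ereal z + ereal r - ereal r) = z" for z r
      by (cases z) (auto simp: enn2ereal_ennreal)
    then show "enn2ereal (\<integral>\<^sup>+ \<omega>. e2ennreal (enn2ereal (?S \<omega>) + ereal (b / (1 - discount M)) -
          ereal (b / (1 - discount M))) \<partial>?T) + ereal (b / (1 - discount M)) =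
        enn2ereal (\<integral>\<^sup>+ \<omega>. ?S \<omega> \<partial>?T) + ereal (b / (1 - discount M))"
      by simp
  qed measurable
  also have "(\<integral>\<^sup>+ \<omega>. ?S \<omega> \<partial>?T) = (\<Sum>t. \<integral>\<^sup>+ \<omega>. ennreal (discount M ^ t) * ennreal (cost M (\<omega> t) - b) \<partial>?T)"
    by (rule nn_integral_suminf) measurable
  also have "\<dots> = excess_value M b \<pi> s"
    unfolding excess_value_def
  proof (rule suminf_cong)
    fix t
    have "(\<integral>\<^sup>+ \<omega>. ennreal (discount M ^ t) * ennreal (cost M (\<omega> t) - b) \<partial>?T)
        = ennreal (discount M ^ t) * (\<integral>\<^sup>+ \<omega>. ennreal (cost M (\<omega> t) - b) \<partial>?T)"
      by (rule nn_integral_cmult) measurable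
    also have "(\<integral>\<^sup>+ \<omega>. ennreal (cost M (\<omega> t) - b) \<partial>?T) = (transition_op M \<pi> ^^ t) (excess_cost M b \<pi>) s"
      unfolding excess_cost_def[abs_def]
      by (rule nn_integral_trajectory[OF M \<pi> s, of "\<lambda>x. ennreal (cost M x - b)"]) measurable
    finally show "(\<integral>\<^sup>+ \<omega>. ennreal (discount M ^ t) * ennreal (cost M (\<omega> t) - b) \<partial>?T)
        = ennreal (discount M ^ t) * (transition_op M \<pi> ^^ t) (excess_cost M b \<pi>) s" .
  qed
  finally show ?thesis .
qed

text \<open>
  The Neumann series \<open>\<Sum>t. \<gamma>\<^sup>t K\<^sup>t c\<close> solves \<open>G = c + \<gamma> K G\<close>, by splitting off its first term.
\<close>

lemma excess_value_fixed_point: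
  assumes M: "is_mdp M" and \<pi>: "\<pi> \<in> policies M" and s: "s \<in> space (states M)"
  shows "excess_value M b \<pi> s =
    excess_cost M b \<pi> s + ennreal (discount M) * transition_op M \<pi> (excess_value M b \<pi>) s"
proof -
  note g = is_mdpD(3,4)[OF M]
  define h where "h t = (transition_op M \<pi> ^^ t) (excess_cost M b \<pi>)" for t
  have hm: "h t \<in> borel_measurable (states M)" for t
    unfolding h_def by (rule transition_op_pow_measurable[OF M \<pi> excess_cost_measurable[OF M \<pi>]])
  then have [measurable]: "h t \<in> borel_measurable (policy_trans M \<pi> s)" for t
    by (simp cong: measurable_cong_sets add: space_policy_trans[OF M \<pi> s])
  have "transition_op M \<pi> (excess_value M b \<pi>) s = (\<integral>\<^sup>+ x. (\<Sum>t. ennreal (discount M ^ t) * h t x) \<partial>policy_trans M \<pi> s)"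
    by (simp add: transition_op_def excess_value_def h_def)
  also have "\<dots> = (\<Sum>t. \<integral>\<^sup>+ x. ennreal (discount M ^ t) * h t x \<partial>policy_trans M \<pi> s)"
    by (rule nn_integral_suminf) measurable
  also have "\<dots> = (\<Sum>t. ennreal (discount M ^ t) * h (Suc t) s)"
  proof (rule suminf_cong)
    fix t
    have "(\<integral>\<^sup>+ x. ennreal (discount M ^ t) * h t x \<partial>policy_trans M \<pi> s)
        = ennreal (discount M ^ t) * (\<integral>\<^sup>+ x. h t x \<partial>policy_trans M \<pi> s)"
      by (rule nn_integral_cmult) measurable
    then show "(\<integral>\<^sup>+ x. ennreal (discount M ^ t) * h t x \<partial>policy_trans M \<pi> s)
        = ennreal (discount M ^ t) * h (Suc t) s"
      by (simp add: h_def transition_op_def)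
  qed
  finally have "ennreal (discount M) * transition_op M \<pi> (excess_value M b \<pi>) s
      = (\<Sum>t. ennreal (discount M ^ Suc t) * h (Suc t) s)"
    using g by (simp add: mult.assoc[symmetric] ennreal_mult[symmetric] flip: ennreal_suminf_cmult)
  moreover have "(\<lambda>t. ennreal (discount M ^ Suc t) * h (Suc t) s) sums (\<Sum>t. ennreal (discount M ^ Suc t) * h (Suc t) s)"
    by (intro summable_sums summableI)
  from sums_Suc[of "\<lambda>t. ennreal (discount M ^ t) * h t s", OF this]
  have "excess_value M b \<pi> s = (\<Sum>t. ennreal (discount M ^ Suc t) * h (Suc t) s) + h 0 s"
    by (simp add: excess_value_def h_def sums_iff)
  ultimately show ?thesis
    by (simp add: h_def add.commute)
qed

section \<open>Contraction of the Bellman operators\<close>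

locale weighted_mdp =
  fixes M :: "('s::polish_space, 'a::polish_space) mdp" and w :: "'s \<Rightarrow> real" and \<kappa> :: real
  assumes mdp: "is_mdp M"
    and weight: "\<And>s. s \<in> space (states M) \<Longrightarrow> 1 \<le> w s"
    and kappa: "0 < \<kappa>" "discount M * \<kappa> < 1"
begin

abbreviation "N \<equiv> states M"
abbreviation "dist_w u v \<equiv> wnorm (states M) w (\<lambda>s. u s - v s)"
abbreviation "wb \<equiv> weighted_bounded (states M) w"

lemmas disc = is_mdpD(3,4)[OF mdp]

lemma wb_finite: "wb v \<Longrightarrow> s \<in> space N \<Longrightarrow> \<bar>v s\<bar> \<noteq> \<infinity>"
  using wnorm_finite[where w = w] weight by (auto simp: weighted_bounded_def)

lemma dist_w_finite:
  assumes "wb u" "wb v"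
  shows "dist_w u v < \<infinity>"
proof -
  have "dist_w u v \<le> wnorm N w (\<lambda>s. u s - 0) + wnorm N w (\<lambda>s. 0 - v s)"
    by (rule wnorm_triangle[OF weight])
  also have "\<dots> < \<infinity>"
    using assms wnorm_commute[of N w "\<lambda>s. 0" v] by (simp add: weighted_bounded_def)
  finally show ?thesis .
qed

lemma stable_policy: "\<pi> \<in> stable_policies M \<kappa> w \<Longrightarrow> \<pi> \<in> policies M"
  by (simp add: stable_policies_def)

text \<open>
  Where stability enters: domination by a multiple of the weight costs a factor \<open>\<kappa>\<close> per transition.
\<close>

lemma stable_transition_le:
  assumes \<pi>: "\<pi> \<in> stable_policies M \<kappa> w" and s: "s \<in> space N"
    and f: "f \<in> borel_measurable N" and K: "K < \<infinity>"
    and le: "\<And>s. s \<in> space N \<Longrightarrow> f s \<le> K * ennreal (w s)"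
  shows "transition_op M \<pi> f s \<le> K * (ennreal \<kappa> * ennreal (w s))"
proof -
  note sp = space_policy_trans[OF mdp stable_policy[OF \<pi>] s]
  have "transition_op M \<pi> f s \<le> K * (\<integral>\<^sup>+ s'. ennreal (w s') \<partial>policy_trans M \<pi> s)"
    unfolding transition_op_def
    using f K le by (intro nn_integral_le_mult) (auto cong: measurable_cong_sets simp: sp)
  also have "\<dots> \<le> K * ennreal (\<kappa> * w s)"
    using \<pi> s by (intro mult_left_mono) (auto simp: stable_policies_def)
  also have "\<dots> = K * (ennreal \<kappa> * ennreal (w s))"
    using kappa weight[OF s] by (simp add: ennreal_mult)
  finally show ?thesis .
qed

lemma wb_transition:
  assumes \<pi>: "\<pi> \<in> stable_policies M \<kappa> w" and s: "s \<in> space N" and u: "wb u" and v: "wb v"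
  shows "\<bar>ext_integral (policy_trans M \<pi> s) u\<bar> \<noteq> \<infinity>"
    and "e2ennreal \<bar>ext_integral (policy_trans M \<pi> s) u - ext_integral (policy_trans M \<pi> s) v\<bar>
      \<le> dist_w u v * (ennreal \<kappa> * ennreal (w s))"
proof -
  note sp = space_policy_trans[OF mdp stable_policy[OF \<pi>] s]
  have m: "x \<in> borel_measurable (policy_trans M \<pi> s)" "x \<in> borel_measurable N" if "wb x" for x
    using that sp by (auto simp: weighted_bounded_def cong: measurable_cong_sets)
  have fin: "(\<integral>\<^sup>+ x. e2ennreal \<bar>v x\<bar> \<partial>policy_trans M \<pi> s) < \<infinity>" if v: "wb v" for v
  proof -
    have "transition_op M \<pi> (\<lambda>x. e2ennreal \<bar>v x\<bar>) s \<le> wnorm N w v * (ennreal \<kappa> * ennreal (w s))"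
      using v m[OF v] by (intro stable_transition_le \<pi> s wnorm_bound weight) (auto simp: weighted_bounded_def)
    also have "\<dots> < \<infinity>"
      using v by (simp add: weighted_bounded_def ennreal_mult_less_top)
    finally show ?thesis by (simp add: transition_op_def)
  qed
  note d = ext_integral_diff_le[OF m(1)[OF u] m(1)[OF v] _ _ fin[OF u] fin[OF v]]
  show "\<bar>ext_integral (policy_trans M \<pi> s) u\<bar> \<noteq> \<infinity>"
    by (rule d(1)) (auto simp: sp wb_finite u v)
  have "e2ennreal \<bar>ext_integral (policy_trans M \<pi> s) u - ext_integral (policy_trans M \<pi> s) v\<bar>
      \<le> transition_op M \<pi> (\<lambda>x. e2ennreal \<bar>u x - v x\<bar>) s"
    unfolding transition_op_def by (rule d(2)) (auto simp: sp wb_finite u v)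
  also have "\<dots> \<le> dist_w u v * (ennreal \<kappa> * ennreal (w s))"
    using m(2)[OF u] m(2)[OF v] dist_w_finite[OF u v]
    by (intro stable_transition_le \<pi> s wnorm_bound weight) auto
  finally show "e2ennreal \<bar>ext_integral (policy_trans M \<pi> s) u - ext_integral (policy_trans M \<pi> s) v\<bar>
      \<le> dist_w u v * (ennreal \<kappa> * ennreal (w s))" .
qed

lemma policy_cost_finite:
  "\<pi> \<in> stable_policies M \<kappa> w \<Longrightarrow> s \<in> space N \<Longrightarrow> \<bar>policy_cost M \<pi> s\<bar> \<noteq> \<infinity>"
  using wnorm_finite[where w = w] weight by (auto simp: stable_policies_def)

lemma bellman_finite:
  assumes \<pi>: "\<pi> \<in> stable_policies M \<kappa> w" and s: "s \<in> space N" and u: "wb u"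
  shows "\<bar>bellman M \<pi> u s\<bar> \<noteq> \<infinity>"
  using wb_transition(1)[OF \<pi> s u u] policy_cost_finite[OF \<pi> s]
  by (cases "policy_cost M \<pi> s"; cases "ext_integral (policy_trans M \<pi> s) u") (auto simp: bellman_def)

lemma bellman_diff_le:
  assumes \<pi>: "\<pi> \<in> stable_policies M \<kappa> w" and s: "s \<in> space N" and u: "wb u" and v: "wb v"
  shows "e2ennreal \<bar>bellman M \<pi> u s - bellman M \<pi> v s\<bar>
    \<le> ennreal (discount M * \<kappa>) * dist_w u v * ennreal (w s)"
proof -
  let ?E = "\<lambda>v. ext_integral (policy_trans M \<pi> s) v"
  have "e2ennreal \<bar>bellman M \<pi> u s - bellman M \<pi> v s\<bar> = ennreal (discount M) * e2ennreal \<bar>?E u - ?E v\<bar>"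
    using wb_transition(1)[OF \<pi> s u u] wb_transition(1)[OF \<pi> s v v] policy_cost_finite[OF \<pi> s] disc
    by (cases "policy_cost M \<pi> s"; cases "?E u"; cases "?E v")
       (auto simp: bellman_def ennreal_mult[symmetric] abs_mult right_diff_distrib[symmetric])
  also have "\<dots> \<le> ennreal (discount M) * (dist_w u v * (ennreal \<kappa> * ennreal (w s)))"
    by (intro mult_left_mono wb_transition(2)[OF \<pi> s u v]) simp
  also have "\<dots> = ennreal (discount M * \<kappa>) * dist_w u v * ennreal (w s)"
    using disc kappa by (simp add: ennreal_mult mult_ac)
  finally show ?thesis .
qed

lemma bellman_contraction:
  assumes "\<pi> \<in> stable_policies M \<kappa> w" "wb u" "wb v"
  shows "dist_w (bellman M \<pi> u) (bellman M \<pi> v) \<le> ennreal (discount M * \<kappa>) * dist_w u v"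
  using bellman_diff_le[OF assms(1) _ assms(2,3)] by (intro wnorm_leI weight)

lemma absorb_contraction:
  assumes u: "wb u" and v: "wb v"
    and le: "dist_w u v \<le> d + ennreal (discount M * \<kappa>) * dist_w u v"
  shows "dist_w u v \<le> ennreal (1 / (1 - discount M * \<kappa>)) * d"
  using le dist_w_finite[OF u v] disc kappa by (intro ennreal_absorb) auto

text \<open>
  Stability of the fixed point of a contraction: its distance to any \<open>v\<close> is controlled by how far
  \<open>v\<close> is from being fixed.
\<close>

lemma policy_perturbation:
  assumes \<pi>: "\<pi> \<in> stable_policies M \<kappa> w" and u: "wb u" and v: "wb v"
    and fp: "\<And>s. s \<in> space N \<Longrightarrow> u s = bellman M \<pi> u s"
  shows "dist_w u v \<le> ennreal (1 / (1 - discount M * \<kappa>)) * dist_w (bellman M \<pi> v) v"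
proof (rule absorb_contraction[OF u v])
  have "dist_w u v = dist_w (bellman M \<pi> u) v"
    by (rule wnorm_cong) (simp add: fp)
  also have "\<dots> \<le> dist_w (bellman M \<pi> u) (bellman M \<pi> v) + dist_w (bellman M \<pi> v) v"
    by (rule wnorm_triangle[OF weight])
  also have "\<dots> \<le> dist_w (bellman M \<pi> v) v + ennreal (discount M * \<kappa>) * dist_w u v"
    using bellman_contraction[OF \<pi> u v] by (simp add: add.commute add_left_mono)
  finally show "dist_w u v \<le> dist_w (bellman M \<pi> v) v + ennreal (discount M * \<kappa>) * dist_w u v" .
qed

text \<open>
  A randomized policy averages the one-step costs of the single actions, and an average is at least
  the infimum. After subtracting lower bounds this is Tonelli for nonnegative integrals, since an integral against the
  policy's transition law is an iterated integral.
\<close>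

lemma bellman_opt_le_bellman:
  assumes \<pi>: "\<pi> \<in> policies M" and s: "s \<in> space N"
    and v[measurable]: "v \<in> borel_measurable N" and lb: "\<And>x. x \<in> space N \<Longrightarrow> ereal b \<le> v x"
  shows "bellman_opt M v s \<le> bellman M \<pi> v s"
proof -
  obtain c where c: "cost_bound M c"
    using mdp by (auto simp: is_mdp_def cost_bound_def)
  note [measurable] = is_mdpD(2)[OF mdp] measurable_prob_algebraD[OF is_mdpD(1)[OF mdp]]
  note sp = space_policy[OF \<pi> s] and st = space_policy_trans[OF mdp \<pi> s]
  interpret \<pi>: prob_space "\<pi> s" by (rule sp(1))
  define h where "h x = e2ennreal (v x - ereal b)" for x
  have h[measurable]: "h \<in> borel_measurable N"
    unfolding h_def[abs_def] by measurable
  define F where "F a = ennreal (cost M (s, a) - c) + ennreal (discount M) * (\<integral>\<^sup>+ x. h x \<partial>trans M (s, a))" for a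
  define k where "k = c + discount M * b"
  have Fm: "F \<in> borel_measurable (actions M)"
    unfolding F_def[abs_def] using s by measurable
  have shift: "ext_integral N' v = enn2ereal (\<integral>\<^sup>+ x. h x \<partial>N') + ereal b"
    if "prob_space N'" "sets N' = sets N" for N'
    unfolding h_def using that sets_eq_imp_space_eq[OF that(2)] lb v
    by (intro ext_integral_shift) (auto cong: measurable_cong_sets)
  have split: "enn2ereal x + ereal c + ereal (discount M) * (enn2ereal y + ereal b)
      = enn2ereal (x + ennreal (discount M) * y) + ereal k" for x y
    unfolding k_def using disc
    by (cases x; cases y)
       (auto simp: enn2ereal_ennreal algebra_simps ennreal_mult_top
          ennreal_mult[symmetric] ennreal_plus[symmetric] simp del: ennreal_plus)
  have act: "ereal (cost M (s, a)) + ereal (discount M) * ext_integral (trans M (s, a)) v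
      = enn2ereal (F a) + ereal k" if a: "a \<in> space (actions M)" for a
  proof -
    have "ereal (cost M (s, a)) = enn2ereal (ennreal (cost M (s, a) - c)) + ereal c"
      using c s a by (auto simp: cost_bound_def space_pair_measure enn2ereal_ennreal)
    then show ?thesis
      using space_trans[OF mdp s a] by (simp add: shift split F_def)
  qed
  have pol: "bellman M \<pi> v s = enn2ereal (\<integral>\<^sup>+ a. F a \<partial>\<pi> s) + ereal k"
  proof -
    have m1: "(\<lambda>a. ennreal (cost M (s, a) - c)) \<in> borel_measurable (actions M)"
      and m2: "(\<lambda>a. \<integral>\<^sup>+ x. h x \<partial>trans M (s, a)) \<in> borel_measurable (actions M)"
      using s by measurable
    have [measurable]: "(\<lambda>a. ennreal (cost M (s, a) - c)) \<in> borel_measurable (\<pi> s)"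
      "(\<lambda>a. \<integral>\<^sup>+ x. h x \<partial>trans M (s, a)) \<in> borel_measurable (\<pi> s)"
      using m1 m2 by (auto cong: measurable_cong_sets simp: sp)
    have "(\<integral>\<^sup>+ a. F a \<partial>\<pi> s) = (\<integral>\<^sup>+ a. ennreal (cost M (s, a) - c) \<partial>\<pi> s)
        + (\<integral>\<^sup>+ a. ennreal (discount M) * (\<integral>\<^sup>+ x. h x \<partial>trans M (s, a)) \<partial>\<pi> s)"
      unfolding F_def by (rule nn_integral_add) measurable
    also have "(\<integral>\<^sup>+ a. ennreal (discount M) * (\<integral>\<^sup>+ x. h x \<partial>trans M (s, a)) \<partial>\<pi> s)
        = ennreal (discount M) * (\<integral>\<^sup>+ a. (\<integral>\<^sup>+ x. h x \<partial>trans M (s, a)) \<partial>\<pi> s)"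
      by (rule nn_integral_cmult) measurable
    finally show ?thesis
      using shift[OF st(1,2)] policy_cost_eq_excess[OF mdp \<pi> c s]
      by (simp add: bellman_def split excess_cost_def nn_integral_policy_trans[OF mdp \<pi> s h])
  qed
  show ?thesis
  proof (cases "\<integral>\<^sup>+ a. F a \<partial>\<pi> s")
    case top
    then show ?thesis by (simp add: pol)
  next
    case (real r)
    \<comment> \<open>truncation at 0 keeps the constant nonnegative, so that it integrates to itself over the action law\<close>
    define i where "i = e2ennreal (bellman_opt M v s - ereal k)"
    have le: "bellman_opt M v s \<le> enn2ereal (F a) + ereal k" if "a \<in> space (actions M)" for a
      unfolding bellman_opt_def act[OF that, symmetric] using that by (rule INF_lower)
    have "i \<le> F a" if "a \<in> space (actions M)" for a
    proof -
      have "bellman_opt M v s - ereal k \<le> enn2ereal (F a)"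
        using le[OF that] by (simp add: ereal_minus_le_iff add.commute)
      from e2ennreal_mono[OF this] show ?thesis by (simp add: i_def)
    qed
    then have "(\<integral>\<^sup>+ a. i \<partial>\<pi> s) \<le> (\<integral>\<^sup>+ a. F a \<partial>\<pi> s)"
      by (intro nn_integral_mono) (simp add: sp)
    then have "i \<le> (\<integral>\<^sup>+ a. F a \<partial>\<pi> s)"
      by (simp add: \<pi>.emeasure_space_1)
    then have "enn2ereal i \<le> enn2ereal (\<integral>\<^sup>+ a. F a \<partial>\<pi> s)"
      by (simp add: less_eq_ennreal.rep_eq)
    moreover have "bellman_opt M v s - ereal k \<le> enn2ereal i"
      unfolding i_def by (cases "0 \<le> bellman_opt M v s - ereal k")
        (auto simp: enn2ereal_e2ennreal e2ennreal_neg zero_ennreal.rep_eq)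
    ultimately have "bellman_opt M v s - ereal k \<le> enn2ereal (\<integral>\<^sup>+ a. F a \<partial>\<pi> s)"
      by simp
    then show ?thesis
      by (simp add: pol ereal_minus_le_iff add.commute)
  qed
qed

text \<open>
  At a fixed state, the difference of the two infima lies between the differences obtained from \<open>\<pi>v\<close> and
  from \<open>\<pi>u\<close>, as each of these policies attains one infimum and bounds the other one from above.
\<close>

lemma bellman_opt_contraction:
  assumes u: "wb u" and v: "wb v"
    and \<pi>u: "\<pi>u \<in> greedy M u \<inter> stable_policies M \<kappa> w" and \<pi>v: "\<pi>v \<in> greedy M v \<inter> stable_policies M \<kappa> w"
  shows "dist_w (bellman_opt M u) (bellman_opt M v) \<le> ennreal (discount M * \<kappa>) * dist_w u v"
proof (rule wnorm_leI[OF weight])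
  fix s assume s: "s \<in> space N"
  have le: "bellman_opt M z s \<le> bellman M \<pi> z s" if "wb z" "\<pi> \<in> stable_policies M \<kappa> w" for z \<pi>
    using that s stable_policy by (auto simp: weighted_bounded_def intro: bellman_opt_le_bellman)
  have eq: "bellman_opt M u s = bellman M \<pi>u u s" "bellman_opt M v s = bellman M \<pi>v v s"
    using \<pi>u \<pi>v s by (auto simp: greedy_def)
  have 1: "bellman M \<pi>u u s \<le> bellman M \<pi>v u s" "bellman M \<pi>v v s \<le> bellman M \<pi>u v s"
    using le[OF u, of \<pi>v] le[OF v, of \<pi>u] \<pi>u \<pi>v eq by auto
  have fin: "\<bar>bellman M \<pi> z s\<bar> \<noteq> \<infinity>" if "wb z" "\<pi> \<in> stable_policies M \<kappa> w" for z \<pi>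
    by (rule bellman_finite[OF that(2) s that(1)])
  have "\<bar>bellman_opt M u s - bellman_opt M v s\<bar>
      \<le> max \<bar>bellman M \<pi>v u s - bellman M \<pi>v v s\<bar> \<bar>bellman M \<pi>u u s - bellman M \<pi>u v s\<bar>"
    using 1 fin[OF u, of \<pi>u] fin[OF u, of \<pi>v] fin[OF v, of \<pi>u] fin[OF v, of \<pi>v] \<pi>u \<pi>v unfolding eq
    by (cases "bellman M \<pi>u u s"; cases "bellman M \<pi>v u s"; cases "bellman M \<pi>u v s"; cases "bellman M \<pi>v v s")
       (auto simp: max_def)
  from e2ennreal_mono[OF this]
  show "e2ennreal \<bar>bellman_opt M u s - bellman_opt M v s\<bar>
      \<le> ennreal (discount M * \<kappa>) * dist_w u v * ennreal (w s)"
    using bellman_diff_le[OF _ s u v, of \<pi>u] bellman_diff_le[OF _ s u v, of \<pi>v] \<pi>u \<pi>v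
    by (auto simp: max_def split: if_splits)
qed

lemma opt_perturbation:
  assumes u: "wb u" and v: "wb v"
    and \<pi>u: "\<pi>u \<in> greedy M u \<inter> stable_policies M \<kappa> w" and \<pi>v: "\<pi>v \<in> greedy M v \<inter> stable_policies M \<kappa> w"
    and fp: "\<And>s. s \<in> space N \<Longrightarrow> u s = bellman_opt M u s"
  shows "dist_w u v \<le> ennreal (1 / (1 - discount M * \<kappa>)) * dist_w (bellman_opt M v) v"
proof (rule absorb_contraction[OF u v])
  have "dist_w u v = dist_w (bellman_opt M u) v"
    by (rule wnorm_cong) (simp flip: fp)
  also have "\<dots> \<le> dist_w (bellman_opt M u) (bellman_opt M v) + dist_w (bellman_opt M v) v"
    by (rule wnorm_triangle[OF weight])
  also have "\<dots> \<le> dist_w (bellman_opt M v) v + ennreal (discount M * \<kappa>) * dist_w u v"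
    using bellman_opt_contraction[OF u v \<pi>u \<pi>v] by (simp add: add.commute add_left_mono)
  finally show "dist_w u v \<le> dist_w (bellman_opt M v) v + ennreal (discount M * \<kappa>) * dist_w u v" .
qed

text \<open>
  A cost of order \<open>K w\<close> has expectation of order \<open>K \<kappa>\<^sup>t w\<close> after \<open>t\<close> steps, so the series is dominated by
  a geometric one with ratio \<open>\<gamma> \<kappa> < 1\<close>.
\<close>

lemma excess_value_le:
  assumes \<pi>: "\<pi> \<in> stable_policies M \<kappa> w" and K: "K < \<infinity>"
    and le: "\<And>s. s \<in> space N \<Longrightarrow> excess_cost M b \<pi> s \<le> K * ennreal (w s)" and s: "s \<in> space N"
  shows "excess_value M b \<pi> s \<le> ennreal (1 / (1 - discount M * \<kappa>)) * K * ennreal (w s)"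
proof -
  define h where "h t = (transition_op M \<pi> ^^ t) (excess_cost M b \<pi>)" for t
  have hm: "h t \<in> borel_measurable N" for t
    unfolding h_def
    by (rule transition_op_pow_measurable[OF mdp stable_policy[OF \<pi>] excess_cost_measurable[OF mdp stable_policy[OF \<pi>]]])
  have h_le: "h t s \<le> K * ennreal (\<kappa> ^ t) * ennreal (w s)" if "s \<in> space N" for t s
    using that
  proof (induction t arbitrary: s)
    case 0
    then show ?case using le by (simp add: h_def)
  next
    case (Suc t)
    have "h (Suc t) s = transition_op M \<pi> (h t) s" by (simp add: h_def)
    also have "\<dots> \<le> K * ennreal (\<kappa> ^ t) * (ennreal \<kappa> * ennreal (w s))"
      using K by (intro stable_transition_le \<pi> Suc hm) (auto simp: ennreal_mult_less_top)
    also have "\<dots> = K * ennreal (\<kappa> ^ Suc t) * ennreal (w s)"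
      using kappa by (simp add: ennreal_mult mult_ac)
    finally show ?case .
  qed
  have "excess_value M b \<pi> s \<le> (\<Sum>t. K * ennreal (w s) * ennreal ((discount M * \<kappa>) ^ t))"
    unfolding excess_value_def h_def[symmetric]
  proof (intro suminf_le summableI)
    fix t
    have "ennreal (discount M ^ t) * h t s \<le> ennreal (discount M ^ t) * (K * ennreal (\<kappa> ^ t) * ennreal (w s))"
      by (intro mult_left_mono h_le s) simp
    also have "\<dots> = K * ennreal (w s) * ennreal ((discount M * \<kappa>) ^ t)"
      using disc kappa by (simp add: ennreal_mult mult_ac power_mult_distrib)
    finally show "ennreal (discount M ^ t) * h t s \<le> K * ennreal (w s) * ennreal ((discount M * \<kappa>) ^ t)" .
  qed
  also have "\<dots> = K * ennreal (w s) * (\<Sum>t. ennreal ((discount M * \<kappa>) ^ t))"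
    by (rule ennreal_suminf_cmult)
  also have "(\<Sum>t. ennreal ((discount M * \<kappa>) ^ t)) = ennreal (1 / (1 - discount M * \<kappa>))"
    using disc kappa by (intro suminf_ennreal_eq geometric_sums) auto
  finally show ?thesis by (simp add: mult_ac)
qed

text \<open>
  Stability bounds the excess cost by a multiple of the weight, which makes the series finite. The constant
  \<open>b / (1 - \<gamma>)\<close> solves the fixed-point equation for a constant cost \<open>b\<close> and the excess part solves the rest.
\<close>

lemma
  assumes \<pi>: "\<pi> \<in> stable_policies M \<kappa> w"
  shows wb_policy_value: "wb (policy_value M \<pi>)"
    and policy_value_fixed_point:
      "s \<in> space N \<Longrightarrow> policy_value M \<pi> s = bellman M \<pi> (policy_value M \<pi>) s"
proof -
  obtain b where b: "cost_bound M b"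
    using mdp by (auto simp: is_mdp_def cost_bound_def)
  define k where "k = b / (1 - discount M)"
  note p = stable_policy[OF \<pi>]
  note pv = policy_value_eq_excess[OF mdp p b, folded k_def]
  note pc = policy_cost_eq_excess[OF mdp p b]
  have [measurable]: "excess_value M b \<pi> \<in> borel_measurable N"
    by (rule excess_value_measurable[OF mdp p])
  have m: "policy_value M \<pi> \<in> borel_measurable N"
    by (subst measurable_cong[OF pv]) measurable
  have lb: "ereal k \<le> policy_value M \<pi> s" if "s \<in> space N" for s
    unfolding pv[OF that] by (cases "excess_value M b \<pi> s") (auto simp: enn2ereal_ennreal)
  define K where "K = wnorm N w (policy_cost M \<pi>) + ennreal \<bar>b\<bar>"
  have K: "K < \<infinity>"
    using \<pi> by (simp add: K_def stable_policies_def)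
  have scale: "ennreal r \<le> ennreal r * ennreal (w s)" if "s \<in> space N" "0 \<le> r" for r s
    using weight[OF that(1)] that(2)
    by (simp add: ennreal_mult[symmetric] ennreal_leI mult_left_mono[of 1 "w s" r, simplified])
  have "excess_cost M b \<pi> s \<le> K * ennreal (w s)" if s: "s \<in> space N" for s
  proof -
    have "excess_cost M b \<pi> s \<le> e2ennreal \<bar>policy_cost M \<pi> s\<bar> + ennreal \<bar>b\<bar>"
      unfolding pc[OF s] by (cases "excess_cost M b \<pi> s")
        (auto simp: enn2ereal_ennreal ennreal_plus[symmetric] intro!: ennreal_leI simp del: ennreal_plus)
    also have "\<dots> \<le> wnorm N w (policy_cost M \<pi>) * ennreal (w s) + ennreal \<bar>b\<bar> * ennreal (w s)"
      by (intro add_mono wnorm_bound weight s scale) simp_all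
    finally show ?thesis by (simp add: K_def distrib_right)
  qed
  note ev = excess_value_le[OF \<pi> K this]
  have "wnorm N w (policy_value M \<pi>) \<le> ennreal (1 / (1 - discount M * \<kappa>)) * K + ennreal \<bar>k\<bar>"
  proof (rule wnorm_leI[OF weight])
    fix s assume s: "s \<in> space N"
    have "e2ennreal \<bar>policy_value M \<pi> s\<bar> \<le> excess_value M b \<pi> s + ennreal \<bar>k\<bar>"
      unfolding pv[OF s] by (cases "excess_value M b \<pi> s")
        (auto simp: enn2ereal_ennreal ennreal_plus[symmetric] intro!: ennreal_leI simp del: ennreal_plus)
    also have "\<dots> \<le> ennreal (1 / (1 - discount M * \<kappa>)) * K * ennreal (w s) + ennreal \<bar>k\<bar> * ennreal (w s)"
      by (intro add_mono ev s scale) simp_all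
    finally show "e2ennreal \<bar>policy_value M \<pi> s\<bar>
        \<le> (ennreal (1 / (1 - discount M * \<kappa>)) * K + ennreal \<bar>k\<bar>) * ennreal (w s)"
      by (simp add: distrib_right)
  qed
  also have "\<dots> < \<infinity>"
    using K by (simp add: ennreal_mult_less_top)
  finally show "wb (policy_value M \<pi>)"
    using m lb by (auto simp: weighted_bounded_def)
  show "policy_value M \<pi> s = bellman M \<pi> (policy_value M \<pi>) s" if s: "s \<in> space N"
  proof -
    note sp = space_policy_trans[OF mdp p s]
    have "ext_integral (policy_trans M \<pi> s) (policy_value M \<pi>)
        = enn2ereal (\<integral>\<^sup>+ x. e2ennreal (policy_value M \<pi> x - ereal k) \<partial>policy_trans M \<pi> s) + ereal k"
      using m lb sp by (intro ext_integral_shift) (auto cong: measurable_cong_sets)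
    also have "(\<integral>\<^sup>+ x. e2ennreal (policy_value M \<pi> x - ereal k) \<partial>policy_trans M \<pi> s)
        = transition_op M \<pi> (excess_value M b \<pi>) s"
      unfolding transition_op_def
    proof (rule nn_integral_cong)
      fix x assume "x \<in> space (policy_trans M \<pi> s)"
      then have "x \<in> space N" by (simp add: sp)
      then show "e2ennreal (policy_value M \<pi> x - ereal k) = excess_value M b \<pi> x"
        by (cases "excess_value M b \<pi> x") (auto simp: pv enn2ereal_ennreal)
    qed
    finally have e: "ext_integral (policy_trans M \<pi> s) (policy_value M \<pi>)
        = enn2ereal (transition_op M \<pi> (excess_value M b \<pi>) s) + ereal k" .
    have k: "k = b + discount M * k"
      using disc by (simp add: k_def field_simps)
    show ?thesis
      unfolding bellman_def e pc[OF s] pv[OF s] excess_value_fixed_point[OF mdp p s, of b]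
      using disc k
      by (cases "excess_cost M b \<pi> s"; cases "transition_op M \<pi> (excess_value M b \<pi>) s")
         (auto simp: enn2ereal_ennreal algebra_simps ennreal_mult_top
          ennreal_mult[symmetric] ennreal_plus[symmetric] simp del: ennreal_plus)
  qed
qed

end

section \<open>Optimal values\<close>

text \<open>
  Two optimal value functions are attained by policies, and each is a lower bound for the value of the other's
  policy. So the choice in \<^const>\<open>opt_value\<close> is irrelevant on the state space.
\<close>

lemma is_opt_value_unique:
  assumes "is_opt_value M V" "is_opt_value M V'" "s \<in> space (states M)"
  shows "V s = V' s"
proof -
  obtain \<pi> \<pi>' where "\<pi> \<in> policies M" "\<pi>' \<in> policies M" "V s = policy_value M \<pi> s" "V' s = policy_value M \<pi>' s"
    using assms unfolding is_opt_value_def by metis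
  then show ?thesis
    using assms unfolding is_opt_value_def by (metis order_antisym)
qed

lemma is_opt_value_opt_value: "is_opt_value M V \<Longrightarrow> is_opt_value M (opt_value M)"
  unfolding opt_value_def by (rule someI[of "is_opt_value M"])

lemma bellman_opt_cong:
  assumes M: "is_mdp M" and s: "s \<in> space (states M)" and eq: "\<And>s. s \<in> space (states M) \<Longrightarrow> u s = v s"
  shows "bellman_opt M u s = bellman_opt M v s"
proof -
  have "ext_integral (trans M (s, a)) u = ext_integral (trans M (s, a)) v" if "a \<in> space (actions M)" for a
    using space_trans(3)[OF M s that] eq by (intro ext_integral_cong) simp
  then show ?thesis by (simp add: bellman_opt_def cong: INF_cong_simp)
qed

lemma bellman_cong:
  assumes M: "is_mdp M" and \<pi>: "\<pi> \<in> policies M" and s: "s \<in> space (states M)"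
    and eq: "\<And>s. s \<in> space (states M) \<Longrightarrow> u s = v s"
  shows "bellman M \<pi> u s = bellman M \<pi> v s"
proof -
  have "ext_integral (policy_trans M \<pi> s) u = ext_integral (policy_trans M \<pi> s) v"
    using space_policy_trans(3)[OF M \<pi> s] eq by (intro ext_integral_cong) simp
  then show ?thesis by (simp add: bellman_def)
qed

lemma dp_solvable_opt_value:
  assumes M: "is_mdp M" and dp: "dp_solvable M cmin w"
  shows "is_opt_value M (opt_value M)"
    and "weighted_bounded (states M) w (opt_value M)"
    and "\<And>s. s \<in> space (states M) \<Longrightarrow> opt_value M s = bellman_opt M (opt_value M) s"
proof -
  obtain V where V: "V \<in> weighted_functions M cmin w" "is_opt_value M V"
      "\<And>s. s \<in> space (states M) \<Longrightarrow> V s = bellman_opt M V s"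
    using dp unfolding dp_solvable_def by blast
  show opt: "is_opt_value M (opt_value M)"
    by (rule is_opt_value_opt_value[OF V(2)])
  have eq: "opt_value M s = V s" if "s \<in> space (states M)" for s
    by (rule is_opt_value_unique[OF opt V(2) that])
  have "opt_value M \<in> borel_measurable (states M)"
    using V(1) by (simp add: eq weighted_functions_def value_functions_def cong: measurable_cong)
  then show "weighted_bounded (states M) w (opt_value M)"
    using V(1) wnorm_cong[of "states M" "opt_value M" V w] eq
    by (auto simp: weighted_bounded_def weighted_functions_def value_functions_def)
  show "opt_value M s = bellman_opt M (opt_value M) s" if "s \<in> space (states M)" for s
    using V(3)[OF that] eq[OF that] bellman_opt_cong[OF M that eq] by simp
qed

section \<open>Affine transformations of the cost\<close>

lemma affine_mdp_simps [simp]: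
  "states (affine_mdp a k M) = states M" "actions (affine_mdp a k M) = actions M"
  "trans (affine_mdp a k M) = trans M" "discount (affine_mdp a k M) = discount M"
  "cost (affine_mdp a k M) = (\<lambda>x. a * cost M x + k)"
  by (simp_all add: affine_mdp_def)

lemma policies_affine [simp]: "policies (affine_mdp a k M) = policies M"
  by (simp add: policies_def)

lemma policy_trans_affine [simp]: "policy_trans (affine_mdp a k M) = policy_trans M"
  by (simp add: policy_trans_def fun_eq_iff)

lemma transition_op_affine [simp]: "transition_op (affine_mdp a k M) = transition_op M"
  by (simp add: transition_op_def fun_eq_iff)

lemma affine_mdp_id: "affine_mdp 1 0 M = M"
  by (simp add: affine_mdp_def)

lemma cost_bound_affine: "cost_bound M b \<Longrightarrow> 0 < a \<Longrightarrow> cost_bound (affine_mdp a k M) (a * b + k)"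
  by (simp add: cost_bound_def)

lemma is_mdp_affine:
  assumes M: "is_mdp M" and a: "0 < a"
  shows "is_mdp (affine_mdp a k M)"
proof -
  obtain b where "cost_bound M b"
    using M by (auto simp: is_mdp_def cost_bound_def)
  from cost_bound_affine[OF this a, of k]
  have "\<exists>b'. \<forall>x\<in>space (states M \<Otimes>\<^sub>M actions M). b' \<le> a * cost M x + k"
    by (intro exI[of _ "a * b + k"]) (simp add: cost_bound_def)
  moreover have "(\<lambda>x. a * cost M x + k) \<in> borel_measurable (states M \<Otimes>\<^sub>M actions M)"
    using is_mdpD(2)[OF M] by measurable
  ultimately show ?thesis
    using M by (simp add: is_mdp_def)
qed

lemma policy_cost_affine:
  assumes M: "is_mdp M" and \<pi>: "\<pi> \<in> policies M" and s: "s \<in> space (states M)" and a: "0 < a"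
  shows "policy_cost (affine_mdp a k M) \<pi> s = ereal a * policy_cost M \<pi> s + ereal k"
proof -
  note [measurable] = is_mdpD(2)[OF M]
  obtain b where b: "cost_bound M b"
    using M by (auto simp: is_mdp_def cost_bound_def)
  have "(\<lambda>a. ereal (cost M (s, a))) \<in> borel_measurable (actions M)"
    using s by measurable
  then have "(\<lambda>a. ereal (cost M (s, a))) \<in> borel_measurable (\<pi> s)"
    by (simp cong: measurable_cong_sets add: space_policy[OF \<pi> s])
  from ext_integral_affine[OF space_policy(1)[OF \<pi> s] this _ a, of b k] show ?thesis
    using b s by (simp add: policy_cost_def cost_bound_def space_policy[OF \<pi> s] space_pair_measure)
qed

text \<open>
  With \<open>k = 0\<close> and \<open>a = 1\<close> this is the shift rule of the Bellman operator, since then the transformed model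
  is \<open>M\<close> itself.
\<close>

lemma bellman_affine:
  assumes M: "is_mdp M" and \<pi>: "\<pi> \<in> policies M" and s: "s \<in> space (states M)" and a: "0 < a"
    and v: "v \<in> borel_measurable (states M)" and lb: "\<And>s. s \<in> space (states M) \<Longrightarrow> ereal b \<le> v s"
  shows "bellman (affine_mdp a k M) \<pi> (\<lambda>s. ereal a * v s + ereal r) s
    = ereal a * bellman M \<pi> v s + ereal (k + discount M * r)"
proof -
  note sp = space_policy_trans[OF M \<pi> s]
  have "ext_integral (policy_trans M \<pi> s) (\<lambda>s. ereal a * v s + ereal r)
      = ereal a * ext_integral (policy_trans M \<pi> s) v + ereal r"
    using v lb a sp by (intro ext_integral_affine[where b = b]) (auto cong: measurable_cong_sets)
  then show ?thesis
    using a is_mdpD(3)[OF M]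
    by (cases "policy_cost M \<pi> s"; cases "ext_integral (policy_trans M \<pi> s) v")
       (auto simp: bellman_def policy_cost_affine[OF M \<pi> s a] algebra_simps)
qed

lemma bij_ereal_affine:
  assumes "0 < a"
  shows "bij (\<lambda>x. ereal a * x + ereal r)"
proof (rule bij_betw_byWitness[where f' = "\<lambda>x. (x - ereal r) / ereal a"])
  show "\<forall>x\<in>UNIV. (ereal a * x + ereal r - ereal r) / ereal a = x"
  proof
    fix x :: ereal
    show "(ereal a * x + ereal r - ereal r) / ereal a = x" using assms by (cases x) auto
  qed
  show "\<forall>x\<in>UNIV. ereal a * ((x - ereal r) / ereal a) + ereal r = x"
  proof
    fix x :: ereal
    show "ereal a * ((x - ereal r) / ereal a) + ereal r = x" using assms by (cases x) auto
  qed
qed auto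

text \<open>
  An increasing bijection of the extended reals commutes with infima.
\<close>

lemma bellman_opt_affine:
  assumes M: "is_mdp M" and s: "s \<in> space (states M)" and a: "0 < a"
    and v: "v \<in> borel_measurable (states M)" and lb: "\<And>s. s \<in> space (states M) \<Longrightarrow> ereal b \<le> v s"
  shows "bellman_opt (affine_mdp a k M) (\<lambda>s. ereal a * v s + ereal r) s
    = ereal a * bellman_opt M v s + ereal (k + discount M * r)"
proof -
  let ?T = "\<lambda>x. ereal a * x + ereal (k + discount M * r)"
  have mono: "mono ?T"
    using a by (auto simp: mono_def intro!: add_mono ereal_mult_left_mono)
  have act: "ereal (a * cost M (s, b') + k) + ereal (discount M) * ext_integral (trans M (s, b')) (\<lambda>s. ereal a * v s + ereal r)
      = ?T (ereal (cost M (s, b')) + ereal (discount M) * ext_integral (trans M (s, b')) v)"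
    if b': "b' \<in> space (actions M)" for b'
  proof -
    note sp = space_trans[OF M s b']
    have "ext_integral (trans M (s, b')) (\<lambda>s. ereal a * v s + ereal r)
        = ereal a * ext_integral (trans M (s, b')) v + ereal r"
      using v lb a sp by (intro ext_integral_affine[where b = b]) (auto cong: measurable_cong_sets)
    then show ?thesis
      using a is_mdpD(3)[OF M]
      by (cases "ext_integral (trans M (s, b')) v") (auto simp: algebra_simps)
  qed
  show ?thesis
    unfolding bellman_opt_def mono_bij_Inf[OF mono bij_ereal_affine[OF a]] image_image
    by (simp add: act cong: INF_cong_simp)
qed

lemma transition_op_pow_cmult:
  assumes M: "is_mdp M" and \<pi>: "\<pi> \<in> policies M" and f: "f \<in> borel_measurable (states M)"
  shows "s \<in> space (states M) \<Longrightarrow>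
    (transition_op M \<pi> ^^ t) (\<lambda>s. c * f s) s = c * (transition_op M \<pi> ^^ t) f s"
proof (induction t arbitrary: s)
  case (Suc t)
  note sp = space_policy_trans[OF M \<pi> Suc.prems]
  have step: "(transition_op M \<pi> ^^ Suc t) g s = (\<integral>\<^sup>+ x. (transition_op M \<pi> ^^ t) g x \<partial>policy_trans M \<pi> s)" for g
    by (simp add: transition_op_def[of M \<pi> _ s])
  have "(transition_op M \<pi> ^^ Suc t) (\<lambda>s. c * f s) s
      = (\<integral>\<^sup>+ x. c * (transition_op M \<pi> ^^ t) f x \<partial>policy_trans M \<pi> s)"
    unfolding step by (intro nn_integral_cong Suc.IH) (simp add: sp)
  also have "\<dots> = c * (transition_op M \<pi> ^^ Suc t) f s"
    unfolding step using transition_op_pow_measurable[OF M \<pi> f, of t] sp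
    by (intro nn_integral_cmult) (simp cong: measurable_cong_sets)
  finally show ?case .
qed simp

text \<open>
  Transforming the lower bound along with the cost makes the excess cost scale by exactly \<open>a\<close>, and the
  Neumann series is linear.
\<close>

lemma policy_value_affine:
  assumes M: "is_mdp M" and \<pi>: "\<pi> \<in> policies M" and s: "s \<in> space (states M)" and a: "0 < a"
  shows "policy_value (affine_mdp a k M) \<pi> s
    = ereal a * policy_value M \<pi> s + ereal (k / (1 - discount M))"
proof -
  obtain b where b: "cost_bound M b"
    using M by (auto simp: is_mdp_def cost_bound_def)
  note [measurable] = is_mdpD(2)[OF M]
  have cost: "excess_cost (affine_mdp a k M) (a * b + k) \<pi> s = ennreal a * excess_cost M b \<pi> s"
    if s: "s \<in> space (states M)" for s
  proof -
    have "(\<lambda>a. ennreal (cost M (s, a) - b)) \<in> borel_measurable (actions M)"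
      using s by measurable
    then have m: "(\<lambda>a. ennreal (cost M (s, a) - b)) \<in> borel_measurable (\<pi> s)"
      by (simp cong: measurable_cong_sets add: space_policy[OF \<pi> s])
    have "excess_cost (affine_mdp a k M) (a * b + k) \<pi> s = (\<integral>\<^sup>+ x. ennreal a * ennreal (cost M (s, x) - b) \<partial>\<pi> s)"
      unfolding excess_cost_def using a b s
      by (intro nn_integral_cong)
         (auto simp: space_policy[OF \<pi> s] cost_bound_def space_pair_measure ennreal_mult[symmetric] algebra_simps)
    also have "\<dots> = ennreal a * excess_cost M b \<pi> s"
      unfolding excess_cost_def by (rule nn_integral_cmult[OF m])
    finally show ?thesis .
  qed
  have "(transition_op M \<pi> ^^ t) (excess_cost (affine_mdp a k M) (a * b + k) \<pi>) s
      = ennreal a * (transition_op M \<pi> ^^ t) (excess_cost M b \<pi>) s" for t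
    using transition_op_pow_cong[OF M \<pi> cost s, where t = t]
      transition_op_pow_cmult[OF M \<pi> excess_cost_measurable[OF M \<pi>] s] by simp
  then have "excess_value (affine_mdp a k M) (a * b + k) \<pi> s = ennreal a * excess_value M b \<pi> s"
    unfolding excess_value_def by (simp add: mult.left_commute flip: ennreal_suminf_cmult)
  moreover have "policy_value (affine_mdp a k M) \<pi> s
      = enn2ereal (excess_value (affine_mdp a k M) (a * b + k) \<pi> s) + ereal ((a * b + k) / (1 - discount M))"
    using policy_value_eq_excess[OF is_mdp_affine[OF M a, of k] _ cost_bound_affine[OF b a, of k], of \<pi> s] \<pi> s by simp
  ultimately show ?thesis
    unfolding policy_value_eq_excess[OF M \<pi> b s] using a
    by (cases "excess_value M b \<pi> s")
       (auto simp: enn2ereal_ennreal ennreal_mult[symmetric] ennreal_mult_top add_divide_distrib algebra_simps)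
qed

text \<open>
  The transformation acts on the values of all policies by the same increasing map, hence preserves optimality.
\<close>

lemma opt_value_affine:
  assumes M: "is_mdp M" and opt: "is_opt_value M V" and a: "0 < a" and s: "s \<in> space (states M)"
  shows "opt_value (affine_mdp a k M) s = ereal a * V s + ereal (k / (1 - discount M))"
proof -
  have "is_opt_value (affine_mdp a k M) (\<lambda>s. ereal a * V s + ereal (k / (1 - discount M)))"
    using opt a unfolding is_opt_value_def
    by (auto simp: policy_value_affine[OF M _ _ a] intro!: add_right_mono ereal_mult_left_mono)
  from is_opt_value_unique[OF is_opt_value_opt_value[OF this] this] s show ?thesis by simp
qed

lemma weighted_bounded_affine:
  assumes w: "\<And>s. s \<in> space N \<Longrightarrow> 1 \<le> w s" and v: "weighted_bounded N w v" and a: "0 < a"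
  shows "weighted_bounded N w (\<lambda>s. ereal a * v s + ereal k)"
proof -
  have m[measurable]: "v \<in> borel_measurable N"
    using v by (simp add: weighted_bounded_def)
  obtain b where "\<And>s. s \<in> space N \<Longrightarrow> ereal b \<le> v s"
    using v by (auto simp: weighted_bounded_def)
  then have lb: "ereal (a * b + k) \<le> ereal a * v s + ereal k" if "s \<in> space N" for s
    using that a by (cases "v s") (auto dest!: meta_spec[of _ s])
  have "wnorm N w (\<lambda>s. ereal a * v s - ereal (- k)) \<le> wnorm N w (\<lambda>s. ereal a * v s - 0) + wnorm N w (\<lambda>s. 0 - ereal (- k))"
    by (rule wnorm_triangle[OF w])
  also have "wnorm N w (\<lambda>s. ereal a * v s - 0) = ennreal a * wnorm N w v"
    using a w by (simp add: wnorm_scale)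
  also have "wnorm N w (\<lambda>s. 0 - ereal (- k)) \<le> ennreal \<bar>k\<bar>"
  proof (rule wnorm_leI[OF w])
    fix s assume "s \<in> space N"
    then show "e2ennreal \<bar>0 - ereal (- k)\<bar> \<le> ennreal \<bar>k\<bar> * ennreal (w s)"
      using mult_left_mono[OF w, of s "\<bar>k\<bar>"] w[of s] by (simp add: ennreal_mult[symmetric] ennreal_leI)
  qed
  finally have "wnorm N w (\<lambda>s. ereal a * v s - ereal (- k)) \<le> ennreal a * wnorm N w v + ennreal \<bar>k\<bar>"
    by (simp add: add_left_mono)
  also have "\<dots> < \<infinity>"
    using v by (simp add: weighted_bounded_def ennreal_mult_less_top)
  finally have "wnorm N w (\<lambda>s. ereal a * v s + ereal k) < \<infinity>"
    by (simp add: minus_ereal_def)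
  then show ?thesis
    using lb by (auto simp: weighted_bounded_def)
qed

lemma stable_policies_affine:
  assumes M: "is_mdp M" and w: "\<And>s. s \<in> space (states M) \<Longrightarrow> 1 \<le> w s" and a: "0 < a"
  shows "stable_policies M \<kappa> w \<subseteq> stable_policies (affine_mdp a k M) \<kappa> w"
proof
  fix \<pi> assume \<pi>: "\<pi> \<in> stable_policies M \<kappa> w"
  then have p: "\<pi> \<in> policies M" by (simp add: stable_policies_def)
  have "weighted_bounded (states M) w (policy_cost M \<pi>)"
  proof -
    obtain b where b: "cost_bound M b"
      using M by (auto simp: is_mdp_def cost_bound_def)
    note pc = policy_cost_eq_excess[OF M p b]
    have [measurable]: "excess_cost M b \<pi> \<in> borel_measurable (states M)"
      by (rule excess_cost_measurable[OF M p])
    have "policy_cost M \<pi> \<in> borel_measurable (states M)"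
      by (subst measurable_cong[OF pc]) measurable
    moreover have "ereal b \<le> policy_cost M \<pi> s" if "s \<in> space (states M)" for s
      unfolding pc[OF that] by (cases "excess_cost M b \<pi> s") (auto simp: enn2ereal_ennreal)
    ultimately show ?thesis
      using \<pi> by (auto simp: weighted_bounded_def stable_policies_def)
  qed
  from weighted_bounded_affine[OF w this a, of k]
  have "wnorm (states M) w (policy_cost (affine_mdp a k M) \<pi>) < \<infinity>"
    by (simp add: weighted_bounded_def policy_cost_affine[OF M p _ a] cong: wnorm_cong)
  then show "\<pi> \<in> stable_policies (affine_mdp a k M) \<kappa> w"
    using \<pi> by (simp add: stable_policies_def)
qed

section \<open>Comparison of two models\<close>

text \<open>
  States, discount, weight and \<open>\<kappa>\<close> are shared, so distances and contraction factors mean the same in both models.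
  In the application \<open>A\<close> is the model with transformed cost. Below, \<open>V\<close> is the optimal value of \<open>A\<close>, \<open>V'\<close> that of
  \<open>B\<close>, and \<open>\<pi>'\<close> the policy obtained from \<open>B\<close> and run in \<open>A\<close>.
\<close>

locale weighted_mdp_pair = A: weighted_mdp A w \<kappa> + B: weighted_mdp B w \<kappa>
  for A B :: "('s::polish_space, 'a::polish_space) mdp" and w \<kappa> +
  assumes states_eq: "states B = states A" and discount_eq: "discount B = discount A"
begin

abbreviation "q \<equiv> discount A * \<kappa>"

text \<open>
  Compare both the value of \<open>\<pi>'\<close> and \<open>V\<close> with \<open>V'\<close>, each as the fixed point of a stable policy's operator in
  \<open>A\<close>. The residual of \<open>V'\<close> is a mismatch because \<open>V'\<close> is fixed in \<open>B\<close>.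
\<close>

lemma policy_error_via_approximate_value:
  assumes \<pi>: "\<pi> \<in> stable_policies A \<kappa> w" and \<pi>': "\<pi>' \<in> stable_policies A \<kappa> w"
    and V: "A.wb V" "\<And>s. s \<in> space A.N \<Longrightarrow> V s = bellman A \<pi> V s"
    and V': "A.wb V'" "\<And>s. s \<in> space A.N \<Longrightarrow> V' s = bellman B \<pi>' V' s"
  shows "A.dist_w (policy_value A \<pi>') V \<le> ennreal (1 / (1 - q)) *
    (A.dist_w (bellman A \<pi>' V') (bellman B \<pi>' V') + A.dist_w (bellman A \<pi> V') (bellman B \<pi>' V'))"
proof -
  have D: "A.dist_w (bellman A p V') V' = A.dist_w (bellman A p V') (bellman B \<pi>' V')" for p
    by (rule wnorm_cong) (simp flip: V'(2))
  have "A.dist_w (policy_value A \<pi>') V \<le> A.dist_w (policy_value A \<pi>') V' + A.dist_w V' V"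
    by (rule wnorm_triangle[OF A.weight])
  also have "A.dist_w V' V = A.dist_w V V'"
    by (rule wnorm_commute)
  also have "A.dist_w (policy_value A \<pi>') V' + A.dist_w V V'
      \<le> ennreal (1 / (1 - q)) * A.dist_w (bellman A \<pi>' V') V' + ennreal (1 / (1 - q)) * A.dist_w (bellman A \<pi> V') V'"
    by (intro add_mono A.policy_perturbation A.wb_policy_value A.policy_value_fixed_point V V'(1) \<pi> \<pi>')
  finally show ?thesis
    by (simp add: D distrib_left)
qed

text \<open>
  Since \<open>V\<close> is fixed by the operator of \<open>\<pi>\<close> in \<open>A\<close>, its residual for \<open>\<pi>'\<close> in \<open>A\<close> splits directly into the two
  mismatches at \<open>V\<close>, both with the factor \<open>1 / (1 - q)\<close>. This is at least as sharp as the factor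
  \<open>(1 + q) / (1 - q)\<^sup>2\<close>.
\<close>

lemma policy_error_via_true_value:
  assumes \<pi>': "\<pi>' \<in> stable_policies A \<kappa> w"
    and V: "A.wb V" "\<And>s. s \<in> space A.N \<Longrightarrow> V s = bellman A \<pi> V s"
  shows "A.dist_w (policy_value A \<pi>') V \<le> ennreal (1 / (1 - q)) *
    (A.dist_w (bellman A \<pi>' V) (bellman B \<pi>' V) + A.dist_w (bellman A \<pi> V) (bellman B \<pi>' V))"
proof -
  have "A.dist_w (policy_value A \<pi>') V \<le> ennreal (1 / (1 - q)) * A.dist_w (bellman A \<pi>' V) V"
    by (intro A.policy_perturbation A.wb_policy_value A.policy_value_fixed_point V(1) \<pi>')
  also have "\<dots> \<le> ennreal (1 / (1 - q)) *
      (A.dist_w (bellman A \<pi>' V) (bellman B \<pi>' V) + A.dist_w (bellman B \<pi>' V) V)"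
    by (intro mult_left_mono wnorm_triangle A.weight) simp_all
  also have "A.dist_w (bellman B \<pi>' V) V = A.dist_w V (bellman B \<pi>' V)"
    by (rule wnorm_commute)
  also have "\<dots> = A.dist_w (bellman A \<pi> V) (bellman B \<pi>' V)"
    by (rule wnorm_cong) (simp flip: V(2))
  finally show ?thesis .
qed

text \<open>
  As with policy mismatches, but \<open>V\<close> is compared with \<open>V'\<close> through the optimality operator, for which a stable
  greedy policy is needed at both functions.
\<close>

lemma opt_error_via_approximate_value:
  assumes \<pi>': "\<pi>' \<in> stable_policies A \<kappa> w"
    and V: "A.wb V" "\<And>s. s \<in> space A.N \<Longrightarrow> V s = bellman_opt A V s"
    and V': "A.wb V'" "\<And>s. s \<in> space A.N \<Longrightarrow> V' s = bellman B \<pi>' V' s"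
      "\<And>s. s \<in> space A.N \<Longrightarrow> V' s = bellman_opt B V' s"
    and greedy: "\<pi> \<in> greedy A V \<inter> stable_policies A \<kappa> w" "\<rho> \<in> greedy A V' \<inter> stable_policies A \<kappa> w"
  shows "A.dist_w (policy_value A \<pi>') V \<le> ennreal (1 / (1 - q)) *
    (A.dist_w (bellman A \<pi>' V') (bellman B \<pi>' V') + A.dist_w (bellman_opt A V') (bellman_opt B V'))"
proof -
  have D: "A.dist_w (bellman A \<pi>' V') V' = A.dist_w (bellman A \<pi>' V') (bellman B \<pi>' V')"
    by (rule wnorm_cong) (simp flip: V'(2))
  have D': "A.dist_w (bellman_opt A V') V' = A.dist_w (bellman_opt A V') (bellman_opt B V')"
    by (rule wnorm_cong) (simp flip: V'(3))
  have "A.dist_w (policy_value A \<pi>') V \<le> A.dist_w (policy_value A \<pi>') V' + A.dist_w V' V"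
    by (rule wnorm_triangle[OF A.weight])
  also have "A.dist_w V' V = A.dist_w V V'"
    by (rule wnorm_commute)
  also have "A.dist_w (policy_value A \<pi>') V' + A.dist_w V V'
      \<le> ennreal (1 / (1 - q)) * A.dist_w (bellman A \<pi>' V') V' + ennreal (1 / (1 - q)) * A.dist_w (bellman_opt A V') V'"
    by (intro add_mono A.policy_perturbation A.opt_perturbation[OF _ _ greedy]
        A.wb_policy_value A.policy_value_fixed_point V V'(1) \<pi>')
  finally show ?thesis
    by (simp add: D D' distrib_left)
qed

text \<open>
  The optimality operator of \<open>B\<close> at \<open>V\<close> need not be the operator of \<open>\<pi>'\<close>, which is greedy at \<open>V'\<close>. The residual
  is therefore routed through the operator of \<open>\<pi>'\<close> at \<open>V'\<close>, which costs \<open>(1 + q) \<parallel>V' - V\<parallel>\<close>, and \<open>\<parallel>V' - V\<parallel>\<close> is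
  itself at most the optimal mismatch at \<open>V\<close> over \<open>1 - q\<close>.
\<close>

lemma opt_error_via_true_value:
  assumes V: "A.wb V" "\<And>s. s \<in> space A.N \<Longrightarrow> V s = bellman_opt A V s"
    and V': "A.wb V'" "\<And>s. s \<in> space A.N \<Longrightarrow> V' s = bellman B \<pi>' V' s"
      "\<And>s. s \<in> space A.N \<Longrightarrow> V' s = bellman_opt B V' s"
    and \<pi>': "\<pi>' \<in> stable_policies A \<kappa> w" "\<pi>' \<in> greedy B V' \<inter> stable_policies B \<kappa> w"
    and \<rho>: "\<rho> \<in> greedy B V \<inter> stable_policies B \<kappa> w"
  shows "A.dist_w (policy_value A \<pi>') V \<le>
    ennreal (1 / (1 - q)) * A.dist_w (bellman A \<pi>' V) (bellman B \<pi>' V)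
    + ennreal ((1 + q) / (1 - q)\<^sup>2) * A.dist_w (bellman_opt A V) (bellman_opt B V)"
proof -
  let ?c = "ennreal (1 / (1 - q))"
  define D where "D = A.dist_w (bellman A \<pi>' V) (bellman B \<pi>' V)"
  define Dopt where "Dopt = A.dist_w (bellman_opt A V) (bellman_opt B V)"
  have q: "0 \<le> q" "q < 1"
    using A.disc A.kappa by auto
  have wbB: "B.wb V" "B.wb V'"
    using V(1) V'(1) by (simp_all add: states_eq)
  have "A.dist_w V' V \<le> ?c * A.dist_w (bellman_opt B V) V"
    using B.opt_perturbation[OF wbB(2,1) \<pi>'(2) \<rho>] V'(3) by (simp add: states_eq discount_eq)
  also have "A.dist_w (bellman_opt B V) V = A.dist_w V (bellman_opt B V)"
    by (rule wnorm_commute)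
  also have "\<dots> = Dopt"
    unfolding Dopt_def by (rule wnorm_cong) (simp flip: V(2))
  finally have V'V: "A.dist_w V' V \<le> ?c * Dopt" .
  have "A.dist_w (policy_value A \<pi>') V \<le> ?c * A.dist_w (bellman A \<pi>' V) V"
    by (intro A.policy_perturbation A.wb_policy_value A.policy_value_fixed_point V(1) \<pi>')
  also have "\<dots> \<le> ?c * (D + A.dist_w (bellman B \<pi>' V) V)"
    unfolding D_def by (intro mult_left_mono wnorm_triangle A.weight) simp_all
  also have "\<dots> \<le> ?c * (D + (A.dist_w (bellman B \<pi>' V) (bellman B \<pi>' V') + A.dist_w (bellman B \<pi>' V') V))"
    by (intro mult_left_mono add_left_mono wnorm_triangle A.weight) simp_all
  also have "A.dist_w (bellman B \<pi>' V') V = A.dist_w V' V"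
    by (rule wnorm_cong) (simp flip: V'(2))
  also have "?c * (D + (A.dist_w (bellman B \<pi>' V) (bellman B \<pi>' V') + A.dist_w V' V))
      \<le> ?c * (D + (ennreal q * (?c * Dopt) + ?c * Dopt))"
  proof (intro mult_left_mono add_left_mono add_mono V'V)
    have "A.dist_w (bellman B \<pi>' V) (bellman B \<pi>' V') \<le> ennreal q * A.dist_w V V'"
      using B.bellman_contraction[of \<pi>' V V'] \<pi>'(2) wbB by (simp add: states_eq discount_eq)
    also have "A.dist_w V V' = A.dist_w V' V"
      by (rule wnorm_commute)
    also have "ennreal q * A.dist_w V' V \<le> ennreal q * (?c * Dopt)"
      by (intro mult_left_mono V'V) simp
    finally show "A.dist_w (bellman B \<pi>' V) (bellman B \<pi>' V') \<le> ennreal q * (?c * Dopt)" .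
  qed simp_all
  also have "\<dots> = ?c * D + ?c * ((ennreal q + 1) * ?c) * Dopt"
    by (simp add: distrib_left distrib_right mult_ac)
  also have "?c * ((ennreal q + 1) * ?c) = ennreal ((1 + q) / (1 - q)\<^sup>2)"
    using q by (simp add: ennreal_mult[symmetric] ennreal_plus[symmetric] ennreal_1[symmetric]
        power2_eq_square add.commute del: ennreal_plus ennreal_1)
  finally show ?thesis
    by (simp add: D_def Dopt_def)
qed

end

theorem theorem3:
  fixes M M' :: "('s::polish_space, 'a::polish_space) mdp"
    and w :: "'s \<Rightarrow> real"
    and \<gamma> \<kappa> cmin \<alpha>1 \<alpha>2 :: real
    and \<pi>s \<pi>s' :: "'s \<Rightarrow> 'a measure"
  assumes "is_mdp M" and "is_mdp M'"
    and "states M' = states M" and "actions M' = actions M"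
    and "discount M = \<gamma>" and "discount M' = \<gamma>"
    and "cost_bound M cmin" and "cost_bound M' cmin"
    and "\<And>s. s \<in> space (states M) \<Longrightarrow> 1 \<le> w s"
    and "\<kappa> > 0" and "\<gamma> * \<kappa> < 1"
    and "dp_solvable M cmin w" and "dp_solvable M' cmin w"
    and "\<pi>s \<in> greedy M (opt_value M) \<inter> stable_policies M \<kappa> w"
    and "\<pi>s' \<in> greedy M' (opt_value M') \<inter> stable_policies M \<kappa> w \<inter> stable_policies M' \<kappa> w"
    and "\<alpha>1 > 0"
  defines "gap \<equiv> wnorm (states M) w (\<lambda>s. policy_value M \<pi>s' s - opt_value M s)"
    and "D \<equiv> mismatch_policy M M' w \<alpha>1 \<alpha>2"
    and "Dopt \<equiv> mismatch_opt M M' w \<alpha>1 \<alpha>2"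
    and "V1 \<equiv> \<lambda>s. ereal \<alpha>1 * opt_value M s"
  shows
    "gap \<le> ennreal (1 / (\<alpha>1 * (1 - \<gamma> * \<kappa>))) *
        (D \<pi>s' \<pi>s' (opt_value M') + D \<pi>s \<pi>s' (opt_value M'))
     \<and> gap \<le> ennreal (1 / (\<alpha>1 * (1 - \<gamma> * \<kappa>))) * D \<pi>s' \<pi>s' V1
          + ennreal ((1 + \<gamma> * \<kappa>) / (\<alpha>1 * (1 - \<gamma> * \<kappa>)\<^sup>2)) * D \<pi>s \<pi>s' V1
     \<and> (greedy (affine_mdp \<alpha>1 \<alpha>2 M) (opt_value M') \<inter> stable_policies M \<kappa> w \<noteq> {} \<longrightarrow>
        gap \<le> ennreal (1 / (\<alpha>1 * (1 - \<gamma> * \<kappa>))) *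
          (D \<pi>s' \<pi>s' (opt_value M') + Dopt (opt_value M')))
     \<and> (greedy M' (opt_value (affine_mdp \<alpha>1 \<alpha>2 M)) \<inter> stable_policies M' \<kappa> w \<noteq> {} \<longrightarrow>
        gap \<le> ennreal (1 / (\<alpha>1 * (1 - \<gamma> * \<kappa>))) * D \<pi>s' \<pi>s' V1
          + ennreal ((1 + \<gamma> * \<kappa>) / (\<alpha>1 * (1 - \<gamma> * \<kappa>)\<^sup>2)) * Dopt V1)"
proof -
  note M = assms(1) and M' = assms(2) and eqs = assms(3-6) and weight = assms(9)
    and a = \<open>\<alpha>1 > 0\<close>
  define A where "A = affine_mdp \<alpha>1 \<alpha>2 M"
  define k where "k = \<alpha>2 / (1 - \<gamma>)"
  define V where "V = (\<lambda>s. ereal \<alpha>1 * opt_value M s + ereal k)"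
  define V' where "V' = opt_value M'"
  have A_eqs: "states A = states M" "discount A = \<gamma>"
    by (simp_all add: A_def eqs)
  interpret weighted_mdp_pair A M' w \<kappa>
  proof
    show "is_mdp A"
      unfolding A_def by (rule is_mdp_affine[OF M a])
  qed (use assms A_eqs in auto)
  have \<gamma>: "0 < \<gamma>" "\<gamma> < 1"
    using A.disc by (simp_all add: A_eqs)
  \<comment> \<open>\<open>k\<close> is the value of a constant cost \<open>\<alpha>2\<close>, so \<open>V\<close> is again a fixed point\<close>
  have k: "k = \<alpha>2 + \<gamma> * k"
    using \<gamma> by (simp add: k_def field_simps)
  have q: "0 \<le> \<gamma> * \<kappa>" "\<gamma> * \<kappa> < 1"
    using \<gamma> assms(10,11) by auto
  note opt = dp_solvable_opt_value[OF M assms(12)]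
  note opt' = dp_solvable_opt_value[OF M' assms(13)]
  obtain b where b: "\<And>s. s \<in> space (states M) \<Longrightarrow> ereal b \<le> opt_value M s"
    using opt(2) by (auto simp: weighted_bounded_def)
  have meas: "opt_value M \<in> borel_measurable (states M)"
    using opt(2) by (simp add: weighted_bounded_def)
  have stable: "\<pi> \<in> stable_policies A \<kappa> w" if "\<pi> \<in> stable_policies M \<kappa> w" for \<pi>
    using stable_policies_affine[where w = w, OF M weight a] that unfolding A_def by blast
  have pol: "\<pi>s \<in> policies M" "\<pi>s' \<in> policies M"
    using assms(14,15) by (auto simp: stable_policies_def)

  have V_wb: "weighted_bounded (states M) w V"
    unfolding V_def by (rule weighted_bounded_affine[OF weight opt(2) a])
  have V_opt: "V s = bellman_opt A V s" if s: "s \<in> space (states M)" for s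
    using bellman_opt_affine[OF M s a meas b, of \<alpha>2 k] opt(3)[OF s] k
    by (simp add: A_def V_def eqs)
  have V_greedy: "\<pi>s \<in> greedy A V"
    using assms(14) unfolding greedy_def A_def V_def
    by (auto simp: bellman_affine[OF M pol(1) _ a meas b] bellman_opt_affine[OF M _ a meas b])
  have V_bellman: "V s = bellman A \<pi>s V s" if s: "s \<in> space (states M)" for s
    using V_greedy V_opt[OF s] s by (simp add: greedy_def A_eqs)
  have V'_wb: "weighted_bounded (states M) w V'"
    using opt'(2) by (simp add: V'_def eqs)
  have V'_opt: "V' s = bellman_opt M' V' s" if "s \<in> space (states M)" for s
    using opt'(3)[of s] that by (simp add: V'_def eqs)
  have V'_bellman: "V' s = bellman M' \<pi>s' V' s" if s: "s \<in> space (states M)" for s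
    using assms(15) V'_opt[OF s] s by (simp add: greedy_def V'_def eqs)

  have gap: "wnorm (states M) w (\<lambda>s. policy_value A \<pi>s' s - V s) = ennreal \<alpha>1 * gap"
  proof -
    have "policy_value A \<pi>s' s - V s = ereal \<alpha>1 * (policy_value M \<pi>s' s - opt_value M s)"
      if s: "s \<in> space (states M)" for s
      unfolding A_def V_def policy_value_affine[OF M pol(2) s a] k_def eqs
      using a b[OF s] by (cases "policy_value M \<pi>s' s"; cases "opt_value M s") (auto simp: algebra_simps)
    then show ?thesis
      unfolding gap_def using a weight by (simp add: wnorm_scale cong: wnorm_cong)
  qed
  \<comment> \<open>the estimates for the transformed model bound \<open>\<alpha>1\<close> times the gap\<close>
  have gap_le: "gap \<le> ennreal (x / \<alpha>1) * X + ennreal (y / \<alpha>1) * Y"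
    if "wnorm (states M) w (\<lambda>s. policy_value A \<pi>s' s - V s) \<le> ennreal x * X + ennreal y * Y" "0 \<le> x" "0 \<le> y" for x y X Y
  proof -
    have "gap = ennreal (1 / \<alpha>1) * (ennreal \<alpha>1 * gap)"
      using a by (simp add: mult.assoc[symmetric] ennreal_mult[symmetric])
    also have "\<dots> \<le> ennreal (1 / \<alpha>1) * (ennreal x * X + ennreal y * Y)"
      using that(1) unfolding gap by (rule mult_left_mono) simp
    also have "\<dots> = ennreal (x / \<alpha>1) * X + ennreal (y / \<alpha>1) * Y"
      using a that(2,3) by (simp add: distrib_left mult.assoc[symmetric] ennreal_mult[symmetric])
    finally show ?thesis .
  qed

  have D: "D \<pi> \<pi>' v = wnorm (states M) w (\<lambda>s. bellman A \<pi> v s - bellman M' \<pi>' v s)" for \<pi> \<pi>' v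
    by (simp add: D_def mismatch_policy_def A_def)
  have Dopt: "Dopt v = wnorm (states M) w (\<lambda>s. bellman_opt A v s - bellman_opt M' v s)" for v
    by (simp add: Dopt_def mismatch_opt_def A_def)
  have V1_meas: "V1 \<in> borel_measurable (states M)"
    unfolding V1_def using meas by measurable
  have V1_lb: "ereal (\<alpha>1 * b) \<le> V1 s" if "s \<in> space (states M)" for s
    unfolding V1_def using b[OF that] a by (cases "opt_value M s") auto
  have V_V1: "V = (\<lambda>s. ereal 1 * V1 s + ereal k)"
    by (simp add: V_def V1_def)
  \<comment> \<open>subtracting a real constant from both operators, which removes the shift by \<open>k\<close> from every mismatch\<close>
  have cancel: "ereal 1 * x + ereal r - (ereal 1 * y + ereal r) = x - y" for x y r
    by (cases x; cases y) auto
  have bellman_V: "bellman X \<pi> V s = ereal 1 * bellman X \<pi> V1 s + ereal (\<gamma> * k)"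
    if "is_mdp X" "states X = states M" "discount X = \<gamma>" "\<pi> \<in> policies X" "s \<in> space (states M)" for X \<pi> s
    using bellman_affine[OF that(1,4), of s 1 V1 "\<alpha>1 * b" 0 k] that V1_meas V1_lb
    by (simp only: V_V1 affine_mdp_id) simp
  have bellman_opt_V: "bellman_opt X V s = ereal 1 * bellman_opt X V1 s + ereal (\<gamma> * k)"
    if "is_mdp X" "states X = states M" "discount X = \<gamma>" "s \<in> space (states M)" for X s
    using bellman_opt_affine[OF that(1), of s 1 V1 "\<alpha>1 * b" 0 k] that V1_meas V1_lb
    by (simp only: V_V1 affine_mdp_id) simp
  have polA: "\<pi>s \<in> policies A" "\<pi>s' \<in> policies A" "\<pi>s' \<in> policies M'"
    using pol assms(15) by (auto simp: A_def stable_policies_def)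
  have D_V1: "D \<pi> \<pi>s' V1 = D \<pi> \<pi>s' V" if "\<pi> \<in> policies A" for \<pi>
    unfolding D by (rule wnorm_cong)
      (simp only: bellman_V[OF A.mdp A_eqs that] bellman_V[OF M' eqs(1,4) polA(3)] cancel)
  have Dopt_V1: "Dopt V1 = Dopt V"
    unfolding Dopt by (rule wnorm_cong)
      (simp only: bellman_opt_V[OF A.mdp A_eqs] bellman_opt_V[OF M' eqs(1,4)] cancel)

  note A_simps = A_eqs D[symmetric] Dopt[symmetric]
  have st: "\<pi>s \<in> stable_policies A \<kappa> w" "\<pi>s' \<in> stable_policies A \<kappa> w" "\<pi>s' \<in> stable_policies M' \<kappa> w"
    using assms(14,15) stable by auto
  have const: "1 / (\<alpha>1 * (1 - \<gamma> * \<kappa>)) = 1 / (1 - \<gamma> * \<kappa>) / \<alpha>1"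
    "(1 + \<gamma> * \<kappa>) / (\<alpha>1 * (1 - \<gamma> * \<kappa>)\<^sup>2) = (1 + \<gamma> * \<kappa>) / (1 - \<gamma> * \<kappa>)\<^sup>2 / \<alpha>1"
    by (simp_all add: mult.commute)
  have nonneg: "0 \<le> 1 / (1 - \<gamma> * \<kappa>)" "0 \<le> (1 + \<gamma> * \<kappa>) / (1 - \<gamma> * \<kappa>)\<^sup>2"
    using q by auto

  have 1: "gap \<le> ennreal (1 / (\<alpha>1 * (1 - \<gamma> * \<kappa>))) * (D \<pi>s' \<pi>s' V' + D \<pi>s \<pi>s' V')"
    unfolding const distrib_left
    by (intro gap_le nonneg)
       (use policy_error_via_approximate_value[OF st(1,2), of V V'] V_wb V_bellman V'_wb V'_bellman
        in \<open>simp add: A_simps distrib_left\<close>)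
  have 2: "gap \<le> ennreal (1 / (\<alpha>1 * (1 - \<gamma> * \<kappa>))) * D \<pi>s' \<pi>s' V1
      + ennreal ((1 + \<gamma> * \<kappa>) / (\<alpha>1 * (1 - \<gamma> * \<kappa>)\<^sup>2)) * D \<pi>s \<pi>s' V1"
    unfolding const D_V1[OF polA(1)] D_V1[OF polA(2)]
  proof (intro gap_le nonneg)
    have "1 / (1 - \<gamma> * \<kappa>) \<le> (1 + \<gamma> * \<kappa>) / (1 - \<gamma> * \<kappa>)\<^sup>2"
    proof -
      have "1 / (1 - \<gamma> * \<kappa>) = (1 - \<gamma> * \<kappa>) / (1 - \<gamma> * \<kappa>)\<^sup>2"
        by (simp add: power2_eq_square)
      also have "\<dots> \<le> (1 + \<gamma> * \<kappa>) / (1 - \<gamma> * \<kappa>)\<^sup>2"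
        using q by (intro divide_right_mono) simp_all
      finally show ?thesis .
    qed
    then have "ennreal (1 / (1 - \<gamma> * \<kappa>)) * D \<pi>s \<pi>s' V \<le> ennreal ((1 + \<gamma> * \<kappa>) / (1 - \<gamma> * \<kappa>)\<^sup>2) * D \<pi>s \<pi>s' V"
      by (intro mult_right_mono ennreal_leI) simp_all
    moreover have "wnorm (states M) w (\<lambda>s. policy_value A \<pi>s' s - V s)
        \<le> ennreal (1 / (1 - \<gamma> * \<kappa>)) * D \<pi>s' \<pi>s' V + ennreal (1 / (1 - \<gamma> * \<kappa>)) * D \<pi>s \<pi>s' V"
      using policy_error_via_true_value[OF st(2), of V \<pi>s] V_wb V_bellman by (simp add: A_simps distrib_left)
    ultimately show "wnorm (states M) w (\<lambda>s. policy_value A \<pi>s' s - V s)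
        \<le> ennreal (1 / (1 - \<gamma> * \<kappa>)) * D \<pi>s' \<pi>s' V + ennreal ((1 + \<gamma> * \<kappa>) / (1 - \<gamma> * \<kappa>)\<^sup>2) * D \<pi>s \<pi>s' V"
      by (meson add_left_mono order_trans)
  qed
  have 3: "gap \<le> ennreal (1 / (\<alpha>1 * (1 - \<gamma> * \<kappa>))) * (D \<pi>s' \<pi>s' V' + Dopt V')"
    if "\<rho> \<in> greedy A V' \<inter> stable_policies M \<kappa> w" for \<rho>
    unfolding const distrib_left
    by (intro gap_le nonneg)
       (use opt_error_via_approximate_value[OF st(2), of V V' \<pi>s \<rho>] V_wb V_opt V'_wb V'_bellman V'_opt
          V_greedy st(1) that stable in \<open>simp add: A_simps distrib_left\<close>)
  have 4: "gap \<le> ennreal (1 / (\<alpha>1 * (1 - \<gamma> * \<kappa>))) * D \<pi>s' \<pi>s' V1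
      + ennreal ((1 + \<gamma> * \<kappa>) / (\<alpha>1 * (1 - \<gamma> * \<kappa>)\<^sup>2)) * Dopt V1"
    if \<rho>: "\<rho> \<in> greedy M' (opt_value A) \<inter> stable_policies M' \<kappa> w" for \<rho>
  proof -
    have eq: "opt_value A s = V s" if "s \<in> space (states M')" for s
      using opt_value_affine[OF M opt(1) a, of s \<alpha>2] that by (simp add: A_def V_def k_def eqs)
    have "\<rho> \<in> policies M'"
      using \<rho> by (simp add: greedy_def)
    then have "\<rho> \<in> greedy M' V"
      using \<rho> bellman_cong[OF M' _ _ eq] bellman_opt_cong[OF M' _ eq] by (simp add: greedy_def)
    then show ?thesis
      unfolding const D_V1[OF polA(2)] Dopt_V1
      by (intro gap_le nonneg)
         (use opt_error_via_true_value[of V V' \<pi>s' \<rho>] V_wb V_opt V'_wb V'_bellman V'_opt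
            st(2,3) assms(15) \<rho> in \<open>simp add: A_simps V'_def\<close>)
  qed
  show ?thesis
    using 1 2 3 4 unfolding V'_def A_def by blast
qed

end
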